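(* Let $R$ be an associative ring and let $F$ be a complex of left $R$-modules with $F_i=0$ for all $i\ll 0$. Let $a,b\in\mathbb{Z}$ be such that $H_i(F)=0$ for all $a<i<b$, and assume that the $R$-module $H_0(\Omega^R_{b-1}(F))$ is not projective. Then $$\operatorname{level}^{\mathcal{P}}(F)\geq b-a+1.$$
   Context: Complexes are homologically graded complexes of left $R$-modules $F=\cdots\to F_{n+1}\xrightarrow{\partial^F_{n+1}}F_n\xrightarrow{\partial^F_n}F_{n-1}\to\cdots$ with $F_i=0$ for all $i\ll0$. Two complexes are quasi-isomorphic if they can be linked by a finite sequence of quasi-isomorphisms (chain maps inducing isomorphisms in homology). Projective level: $\operatorname{level}^{\mathcal{P}}(F)$ is the least integer $n\geq 0$ such that $F$ is quasi-isomorphic to a direct summand of a complex $P$ having a filtration by subcomplexes $0=P(0)\subseteq P(1)\subseteq\cdots\subseteq P(n)=P$ in which each quotient $P(i)/P(i-1)$, $1\le i\le n$, is a bounded complex of projective $R$-modules with zero differentials; if no such $n$ exists, $\operatorname{level}^{\mathcal{P}}(F)=\infty$. Syzygies: choose a projective resolution $P\to F$, i.e. a quasi-isomorphism from a complex $P$ of projective modules with $P_i=0$ for $i\ll0$. For $n\in\mathbb{Z}$ let $P_{\geq n}$ be the hard truncation $\cdots\to P_{n+1}\to P_n\to 0$ and $\Omega^R_n(F):=\Sigma^{-n}(P_{\geq n})$, the shift placing $P_n$ in degree $0$. Thus $H_0(\Omega^R_n(F))=P_n/\operatorname{Im}(\partial^P_{n+1})$; whether this module is projective does not depend on the choice of $P$.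 *)

theory Defs
  imports "HOL-Algebra.AbelCoset" "HOL-Algebra.Module" "HOL-Library.Extended_Nat"
begin

section \<open>Left modules over an associative ring\<close>

text \<open>The library locale \<open>module\<close> requires a commutative ring of scalars, so left modules are
  defined here for an arbitrary (associative, unital) ring, on the same record type. The fields
  \<open>mult\<close> and \<open>one\<close> of that record play no role.\<close>

locale left_module = R?: ring R + M?: abelian_group M
  for R :: "('r, 'x) ring_scheme" (structure) and M :: "('r, 'm) module" (structure) +
  assumes smult_closed [simp, intro]:
      "\<lbrakk>r \<in> carrier R; x \<in> carrier M\<rbrakk> \<Longrightarrow> r \<odot>\<^bsub>M\<^esub> x \<in> carrier M"
    and smult_l_distr:
      "\<lbrakk>r \<in> carrier R; s \<in> carrier R; x \<in> carrier M\<rbrakk> \<Longrightarrow>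
        (r \<oplus>\<^bsub>R\<^esub> s) \<odot>\<^bsub>M\<^esub> x = r \<odot>\<^bsub>M\<^esub> x \<oplus>\<^bsub>M\<^esub> s \<odot>\<^bsub>M\<^esub> x"
    and smult_r_distr:
      "\<lbrakk>r \<in> carrier R; x \<in> carrier M; y \<in> carrier M\<rbrakk> \<Longrightarrow>
        r \<odot>\<^bsub>M\<^esub> (x \<oplus>\<^bsub>M\<^esub> y) = r \<odot>\<^bsub>M\<^esub> x \<oplus>\<^bsub>M\<^esub> r \<odot>\<^bsub>M\<^esub> y"
    and smult_assoc:
      "\<lbrakk>r \<in> carrier R; s \<in> carrier R; x \<in> carrier M\<rbrakk> \<Longrightarrow>
        (r \<otimes>\<^bsub>R\<^esub> s) \<odot>\<^bsub>M\<^esub> x = r \<odot>\<^bsub>M\<^esub> (s \<odot>\<^bsub>M\<^esub> x)"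
    and smult_one [simp]: "x \<in> carrier M \<Longrightarrow> \<one>\<^bsub>R\<^esub> \<odot>\<^bsub>M\<^esub> x = x"

definition lin_hom ::
    "('r, 'x) ring_scheme \<Rightarrow> ('r, 'm) module \<Rightarrow> ('r, 'n) module \<Rightarrow> ('m \<Rightarrow> 'n) set" where
  "lin_hom R M N = {h \<in> hom (add_monoid M) (add_monoid N).
     \<forall>r \<in> carrier R. \<forall>x \<in> carrier M. h (r \<odot>\<^bsub>M\<^esub> x) = r \<odot>\<^bsub>N\<^esub> h x}"

definition zero_module :: "('r, 'm) module \<Rightarrow> bool" where
  "zero_module M \<longleftrightarrow> carrier M = {\<zero>\<^bsub>M\<^esub>}"

definition quot_module :: "('r, 'm) module \<Rightarrow> 'm set \<Rightarrow> ('r, 'm set) module" where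
  "quot_module M N = \<lparr>carrier = a_rcosets\<^bsub>M\<^esub> N, mult = undefined, one = undefined,
     zero = N, add = set_add M, smult = (\<lambda>r A. set_add M N ((\<lambda>x. r \<odot>\<^bsub>M\<^esub> x) ` A))\<rparr>"

text \<open>For a homomorphism \<open>h\<close> into \<open>M'\<close>, the map on cosets \<open>N + x \<mapsto> N' + h x\<close>.\<close>

definition quot_map :: "('r, 'n) module \<Rightarrow> 'n set \<Rightarrow> ('m \<Rightarrow> 'n) \<Rightarrow> 'm set \<Rightarrow> 'n set" where
  "quot_map M' N' h = (\<lambda>A. set_add M' N' (h ` A))"

definition free_module :: "('r, 'x) ring_scheme \<Rightarrow> 'b set \<Rightarrow> ('r, 'b \<Rightarrow> 'r) module" where
  "free_module R B = \<lparr>carrier = {f. (\<forall>x \<in> B. f x \<in> carrier R) \<and> (\<forall>x. x \<notin> B \<longrightarrow> f x = \<zero>\<^bsub>R\<^esub>) \<and>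
       finite {x. f x \<noteq> \<zero>\<^bsub>R\<^esub>}},
     mult = undefined, one = undefined,
     zero = (\<lambda>x. \<zero>\<^bsub>R\<^esub>), add = (\<lambda>f g x. f x \<oplus>\<^bsub>R\<^esub> g x), smult = (\<lambda>r f x. r \<otimes>\<^bsub>R\<^esub> f x)\<rparr>"

text \<open>A module is projective if it is, up to isomorphism, a direct summand (a retract) of a free
  module. Taking the basis inside the type of \<open>M\<close> loses nothing: if \<open>M\<close> is a retract of any
  projective module at all, then the canonical surjection from the free module on \<open>carrier M\<close>
  onto \<open>M\<close> splits.\<close>

definition projective :: "('r, 'x) ring_scheme \<Rightarrow> ('r, 'm) module \<Rightarrow> bool" where
  "projective R M \<longleftrightarrow> left_module R M \<and>
     (\<exists>(B :: 'm set) s p. s \<in> lin_hom R M (free_module R B) \<and> p \<in> lin_hom R (free_module R B) M \<and>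
        (\<forall>x \<in> carrier M. p (s x) = x))"


section \<open>Complexes\<close>

text \<open>\<open>diff C i\<close> is the differential from degree \<open>i\<close> to degree \<open>i - 1\<close>.\<close>

record ('r, 'm) cplx =
  obj :: "int \<Rightarrow> ('r, 'm) module"
  diff :: "int \<Rightarrow> 'm \<Rightarrow> 'm"

text \<open>By convention all complexes vanish in sufficiently small degrees.\<close>

definition is_complex :: "('r, 'x) ring_scheme \<Rightarrow> ('r, 'm) cplx \<Rightarrow> bool" where
  "is_complex R C \<longleftrightarrow>
     (\<forall>i. left_module R (obj C i)) \<and>
     (\<forall>i. diff C i \<in> lin_hom R (obj C i) (obj C (i - 1))) \<and>
     (\<forall>i. \<forall>x \<in> carrier (obj C i). diff C (i - 1) (diff C i x) = \<zero>\<^bsub>obj C (i - 1 - 1)\<^esub>) \<and>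
     (\<exists>N. \<forall>i < N. zero_module (obj C i))"

definition cycles :: "('r, 'm) cplx \<Rightarrow> int \<Rightarrow> 'm set" where
  "cycles C i = a_kernel (obj C i) (obj C (i - 1)) (diff C i)"

definition boundaries :: "('r, 'm) cplx \<Rightarrow> int \<Rightarrow> 'm set" where
  "boundaries C i = diff C (i + 1) ` carrier (obj C (i + 1))"

definition homology :: "('r, 'm) cplx \<Rightarrow> int \<Rightarrow> ('r, 'm set) module" where
  "homology C i = quot_module ((obj C i)\<lparr>carrier := cycles C i\<rparr>) (boundaries C i)"

definition chain_map ::
    "('r, 'x) ring_scheme \<Rightarrow> ('r, 'm) cplx \<Rightarrow> ('r, 'n) cplx \<Rightarrow> (int \<Rightarrow> 'm \<Rightarrow> 'n) \<Rightarrow> bool" where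
  "chain_map R C D f \<longleftrightarrow>
     (\<forall>i. f i \<in> lin_hom R (obj C i) (obj D i)) \<and>
     (\<forall>i. \<forall>x \<in> carrier (obj C i). f (i - 1) (diff C i x) = diff D i (f i x))"

definition homology_map :: "('r, 'n) cplx \<Rightarrow> (int \<Rightarrow> 'm \<Rightarrow> 'n) \<Rightarrow> int \<Rightarrow> 'm set \<Rightarrow> 'n set" where
  "homology_map D f i = quot_map (obj D i) (boundaries D i) (f i)"

definition quasi_iso ::
    "('r, 'x) ring_scheme \<Rightarrow> ('r, 'm) cplx \<Rightarrow> ('r, 'n) cplx \<Rightarrow> (int \<Rightarrow> 'm \<Rightarrow> 'n) \<Rightarrow> bool" where
  "quasi_iso R C D f \<longleftrightarrow> is_complex R C \<and> is_complex R D \<and> chain_map R C D f \<and>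
     (\<forall>i. bij_betw (homology_map D f i) (carrier (homology C i)) (carrier (homology D i)))"

text \<open>A finite zigzag of quasi-isomorphisms from \<open>F\<close> to \<open>S\<close>. The two ends may have different
  element types; the intermediate complexes have the element type of \<open>S\<close>.\<close>

definition quasi_isomorphic ::
    "('r, 'x) ring_scheme \<Rightarrow> ('r, 'm) cplx \<Rightarrow> ('r, 'u) cplx \<Rightarrow> bool" where
  "quasi_isomorphic R F S \<longleftrightarrow>
     (\<exists>X :: ('r, 'u) cplx. ((\<exists>f. quasi_iso R F X f) \<or> (\<exists>f. quasi_iso R X F f)) \<and>
        equivclp (\<lambda>Y Z. \<exists>f. quasi_iso R Y Z f) X S)"


section \<open>Subcomplexes, quotients and projective level\<close>

definition subcomplex ::
    "('r, 'x) ring_scheme \<Rightarrow> ('r, 'm) cplx \<Rightarrow> (int \<Rightarrow> 'm set) \<Rightarrow> bool" where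
  "subcomplex R C G \<longleftrightarrow>
     (\<forall>i. submodule (G i) R (obj C i)) \<and> (\<forall>i. diff C i ` G i \<subseteq> G (i - 1))"

definition sub_cplx :: "('r, 'm) cplx \<Rightarrow> (int \<Rightarrow> 'm set) \<Rightarrow> ('r, 'm) cplx" where
  "sub_cplx C G = \<lparr>obj = (\<lambda>i. (obj C i)\<lparr>carrier := G i\<rparr>), diff = diff C\<rparr>"

definition quot_cplx :: "('r, 'm) cplx \<Rightarrow> (int \<Rightarrow> 'm set) \<Rightarrow> ('r, 'm set) cplx" where
  "quot_cplx C G = \<lparr>obj = (\<lambda>i. quot_module (obj C i) (G i)),
     diff = (\<lambda>i. quot_map (obj C (i - 1)) (G (i - 1)) (diff C i))\<rparr>"

definition direct_summand ::
    "('r, 'x) ring_scheme \<Rightarrow> ('r, 'm) cplx \<Rightarrow> (int \<Rightarrow> 'm set) \<Rightarrow> bool" where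
  "direct_summand R C G \<longleftrightarrow> subcomplex R C G \<and>
     (\<exists>H. subcomplex R C H \<and>
        (\<forall>i. G i \<inter> H i = {\<zero>\<^bsub>obj C i\<^esub>} \<and> set_add (obj C i) (G i) (H i) = carrier (obj C i)))"

definition bounded_complex :: "('r, 'm) cplx \<Rightarrow> bool" where
  "bounded_complex C \<longleftrightarrow> (\<exists>N. \<forall>i. \<bar>i\<bar> > N \<longrightarrow> zero_module (obj C i))"

definition zero_differentials :: "('r, 'm) cplx \<Rightarrow> bool" where
  "zero_differentials C \<longleftrightarrow> (\<forall>i. \<forall>x \<in> carrier (obj C i). diff C i x = \<zero>\<^bsub>obj C (i - 1)\<^esub>)"

definition projective_filtration ::
    "('r, 'x) ring_scheme \<Rightarrow> ('r, 'm) cplx \<Rightarrow> nat \<Rightarrow> (nat \<Rightarrow> int \<Rightarrow> 'm set) \<Rightarrow> bool" where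
  "projective_filtration R P n G \<longleftrightarrow>
     (\<forall>k \<le> n. subcomplex R P (G k)) \<and>
     (\<forall>i. G 0 i = {\<zero>\<^bsub>obj P i\<^esub>}) \<and>
     (\<forall>i. G n i = carrier (obj P i)) \<and>
     (\<forall>k \<in> {1..n}. (\<forall>i. G (k - 1) i \<subseteq> G k i) \<and>
        (let Q = quot_cplx (sub_cplx P (G k)) (G (k - 1))
         in bounded_complex Q \<and> (\<forall>i. projective R (obj Q i)) \<and> zero_differentials Q))"

text \<open>A type-theoretic proviso: \<open>P\<close> and the intermediate complexes of the zigzag range over all
  complexes with elements in the type \<open>'u\<close>. Any particular witness lives in some type, so a lower
  bound for the projective level is to be stated for every type \<open>'u\<close>.\<close>

definition proj_level ::
    "'u itself \<Rightarrow> ('r, 'x) ring_scheme \<Rightarrow> ('r, 'm) cplx \<Rightarrow> enat" where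
  "proj_level _ R F = Inf {enat n |n. \<exists>(P :: ('r, 'u) cplx) S G.
     is_complex R P \<and> projective_filtration R P n G \<and>
     direct_summand R P S \<and> quasi_isomorphic R F (sub_cplx P S)}"


section \<open>Syzygies\<close>

definition projective_resolution ::
    "('r, 'x) ring_scheme \<Rightarrow> ('r, 'p) cplx \<Rightarrow> ('r, 'm) cplx \<Rightarrow> bool" where
  "projective_resolution R P F \<longleftrightarrow>
     (\<forall>i. projective R (obj P i)) \<and> (\<exists>f. quasi_iso R P F f)"

definition hard_trunc :: "int \<Rightarrow> ('r, 'm) cplx \<Rightarrow> ('r, 'm) cplx" where
  "hard_trunc n C =
     \<lparr>obj = (\<lambda>i. if n \<le> i then obj C i else (obj C i)\<lparr>carrier := {\<zero>\<^bsub>obj C i\<^esub>}\<rparr>),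
      diff = (\<lambda>i. if n < i then diff C i else (\<lambda>x. \<zero>\<^bsub>obj C (i - 1)\<^esub>))\<rparr>"

text \<open>The \<open>k\<close>-fold suspension, \<open>(\<Sigma>\<^sup>k C)\<^sub>i = C\<^sub>i\<^sub>-\<^sub>k\<close>, with differential multiplied by \<open>(-1)\<^sup>k\<close>.\<close>

definition shift :: "int \<Rightarrow> ('r, 'm) cplx \<Rightarrow> ('r, 'm) cplx" where
  "shift k C = \<lparr>obj = (\<lambda>i. obj C (i - k)),
     diff = (\<lambda>i x. if even k then diff C (i - k) x
                   else \<ominus>\<^bsub>obj C (i - k - 1)\<^esub> (diff C (i - k) x))\<rparr>"

text \<open>The syzygy complex computed from a projective resolution \<open>P\<close>.\<close>

definition syzygy :: "int \<Rightarrow> ('r, 'p) cplx \<Rightarrow> ('r, 'p) cplx" where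
  "syzygy n P = shift (- n) (hard_trunc n P)"

end

theory Submission
  imports Defs
begin

text \<open>Let \<open>F\<close> be quasi-isomorphic to a summand \<open>S\<close> of a complex \<open>C\<close> with an \<open>n\<close>-step filtration, and suppose
  \<open>n \<le> b - a\<close>. Since \<open>S\<close> and \<open>P\<close> are bounded below complexes of projectives, there are chain maps
  \<open>f : S \<rightarrow> P\<close> and \<open>g : P \<rightarrow> S\<close> with a homotopy \<open>t\<close> from \<open>f g\<close> to the identity. Let \<open>u : C \<rightarrow> S \<rightarrow> P\<close> be the
  retraction onto \<open>S\<close> followed by \<open>f\<close>. As \<open>P\<close> is exact in the degrees strictly between \<open>a\<close> and \<open>b\<close>, a
  homotopy can be extended by one filtration step for each of these degrees, which yields a linear
  \<open>\<sigma> : C\<^sub>b\<^sub>-\<^sub>1 \<rightarrow> P\<^sub>b\<close> with \<open>\<partial>u = \<partial>\<sigma>\<partial>\<close> on \<open>C\<^sub>b\<close>; this is the ghost lemma for the map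
  \<open>P \<rightarrow> \<Sigma>\<^sup>b(Im \<partial>\<^sub>b)\<close>, a composite of \<open>b - a\<close> ghosts. Then \<open>\<partial>(t + \<sigma>g)\<close> is a retraction of \<open>P\<^sub>b\<^sub>-\<^sub>1\<close> onto
  \<open>Im \<partial>\<^sub>b\<close>, so that \<open>H\<^sub>0(\<Omega>\<^sub>b\<^sub>-\<^sub>1 F) = P\<^sub>b\<^sub>-\<^sub>1 / Im \<partial>\<^sub>b\<close> is projective.\<close>

section \<open>Module theory over an arbitrary ring: linear maps, restriction and corestriction,
  submodules\<close>

section \<open>Linear maps\<close>

lemma left_module_abelian_group: "left_module R M \<Longrightarrow> abelian_group M"
  by (simp add: left_module_def)

lemma lin_homI:
  assumes "\<And>x. x \<in> carrier M \<Longrightarrow> h x \<in> carrier N"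
    and "\<And>x y. x \<in> carrier M \<Longrightarrow> y \<in> carrier M \<Longrightarrow> h (x \<oplus>\<^bsub>M\<^esub> y) = h x \<oplus>\<^bsub>N\<^esub> h y"
    and "\<And>r x. r \<in> carrier R \<Longrightarrow> x \<in> carrier M \<Longrightarrow> h (r \<odot>\<^bsub>M\<^esub> x) = r \<odot>\<^bsub>N\<^esub> h x"
  shows "h \<in> lin_hom R M N"
  using assms by (auto simp: lin_hom_def hom_def)

lemma lin_hom_closed: "h \<in> lin_hom R M N \<Longrightarrow> x \<in> carrier M \<Longrightarrow> h x \<in> carrier N"
  by (auto simp: lin_hom_def hom_def)

lemma lin_hom_add:
  "h \<in> lin_hom R M N \<Longrightarrow> x \<in> carrier M \<Longrightarrow> y \<in> carrier M \<Longrightarrow> h (x \<oplus>\<^bsub>M\<^esub> y) = h x \<oplus>\<^bsub>N\<^esub> h y"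
  by (auto simp: lin_hom_def hom_def)

lemma lin_hom_smult:
  "h \<in> lin_hom R M N \<Longrightarrow> r \<in> carrier R \<Longrightarrow> x \<in> carrier M \<Longrightarrow> h (r \<odot>\<^bsub>M\<^esub> x) = r \<odot>\<^bsub>N\<^esub> h x"
  by (auto simp: lin_hom_def hom_def)

text \<open>This bridge to the library's homomorphism locale supplies preservation of zero and of
  negatives.\<close>

lemma lin_hom_abelian_group_hom:
  assumes "left_module R M" "left_module R N" "h \<in> lin_hom R M N"
  shows "abelian_group_hom M N h"
  using assms
  by (intro abelian_group_homI left_module_abelian_group group_hom.intro group_hom_axioms.intro
      abelian_group.a_group) (auto simp: lin_hom_def)

lemma lin_hom_zero:
  "left_module R M \<Longrightarrow> left_module R N \<Longrightarrow> h \<in> lin_hom R M N \<Longrightarrow> h \<zero>\<^bsub>M\<^esub> = \<zero>\<^bsub>N\<^esub>"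
  by (rule abelian_group_hom.hom_zero[OF lin_hom_abelian_group_hom])

lemma lin_hom_minus:
  assumes "left_module R M" "left_module R N" "h \<in> lin_hom R M N" "x \<in> carrier M" "y \<in> carrier M"
  shows "h (x \<ominus>\<^bsub>M\<^esub> y) = h x \<ominus>\<^bsub>N\<^esub> h y"
proof -
  interpret abelian_group_hom M N h using assms by (intro lin_hom_abelian_group_hom)
  show ?thesis using assms by (simp add: a_minus_def)
qed

lemma lin_hom_comp:
  "f \<in> lin_hom R L M \<Longrightarrow> g \<in> lin_hom R M N \<Longrightarrow> (\<lambda>x. g (f x)) \<in> lin_hom R L N"
  by (intro lin_homI) (simp_all add: lin_hom_closed lin_hom_add lin_hom_smult)

lemma lin_hom_id: "(\<lambda>x. x) \<in> lin_hom R M M"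
  by (intro lin_homI) simp_all

lemma lin_hom_restrict:
  "f \<in> lin_hom R M N \<Longrightarrow> H \<subseteq> carrier M \<Longrightarrow> f \<in> lin_hom R (M\<lparr>carrier := H\<rparr>) N"
  by (intro lin_homI) (auto simp: lin_hom_closed lin_hom_add lin_hom_smult subset_iff)

lemma lin_hom_corestrict:
  "f \<in> lin_hom R M N \<Longrightarrow> (\<And>x. x \<in> carrier M \<Longrightarrow> f x \<in> K) \<Longrightarrow> f \<in> lin_hom R M (N\<lparr>carrier := K\<rparr>)"
  by (intro lin_homI) (auto simp: lin_hom_closed lin_hom_add lin_hom_smult)

lemma lin_hom_expand:
  "f \<in> lin_hom R M (N\<lparr>carrier := K\<rparr>) \<Longrightarrow> K \<subseteq> carrier N \<Longrightarrow> f \<in> lin_hom R M N"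
  by (auto simp: lin_hom_def hom_def)

context left_module
begin

lemma smult_r_null [simp]:
  assumes "r \<in> carrier R" shows "r \<odot>\<^bsub>M\<^esub> \<zero>\<^bsub>M\<^esub> = \<zero>\<^bsub>M\<^esub>"
proof -
  have "r \<odot>\<^bsub>M\<^esub> \<zero>\<^bsub>M\<^esub> = r \<odot>\<^bsub>M\<^esub> \<zero>\<^bsub>M\<^esub> \<oplus>\<^bsub>M\<^esub> r \<odot>\<^bsub>M\<^esub> \<zero>\<^bsub>M\<^esub>"
    using smult_r_distr[of r "\<zero>\<^bsub>M\<^esub>" "\<zero>\<^bsub>M\<^esub>"] assms by simp
  then show ?thesis using assms by (metis M.add.r_cancel_one' M.zero_closed smult_closed)
qed

lemma smult_l_null [simp]:
  assumes "x \<in> carrier M" shows "\<zero>\<^bsub>R\<^esub> \<odot>\<^bsub>M\<^esub> x = \<zero>\<^bsub>M\<^esub>"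
proof -
  have "\<zero>\<^bsub>R\<^esub> \<odot>\<^bsub>M\<^esub> x = \<zero>\<^bsub>R\<^esub> \<odot>\<^bsub>M\<^esub> x \<oplus>\<^bsub>M\<^esub> \<zero>\<^bsub>R\<^esub> \<odot>\<^bsub>M\<^esub> x"
    using smult_l_distr[of "\<zero>\<^bsub>R\<^esub>" "\<zero>\<^bsub>R\<^esub>" x] assms by simp
  then show ?thesis using assms by (metis M.add.r_cancel_one' R.zero_closed smult_closed)
qed

lemma smult_r_minus:
  assumes "r \<in> carrier R" "x \<in> carrier M" shows "r \<odot>\<^bsub>M\<^esub> (\<ominus>\<^bsub>M\<^esub> x) = \<ominus>\<^bsub>M\<^esub> (r \<odot>\<^bsub>M\<^esub> x)"
proof -
  have "r \<odot>\<^bsub>M\<^esub> (\<ominus>\<^bsub>M\<^esub> x) \<oplus>\<^bsub>M\<^esub> r \<odot>\<^bsub>M\<^esub> x = \<zero>\<^bsub>M\<^esub>"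
    using smult_r_distr[of r "\<ominus>\<^bsub>M\<^esub> x" x] assms by (simp add: M.l_neg)
  then show ?thesis using assms by (simp add: M.minus_equality)
qed

lemma smult_finsum:
  assumes "finite S" "r \<in> carrier R" "f \<in> S \<rightarrow> carrier M"
  shows "r \<odot>\<^bsub>M\<^esub> (\<Oplus>\<^bsub>M\<^esub>i\<in>S. f i) = (\<Oplus>\<^bsub>M\<^esub>i\<in>S. r \<odot>\<^bsub>M\<^esub> f i)"
  using assms by (induct set: finite) (simp_all add: Pi_def smult_r_distr)

lemma lin_hom_zero_map: "(\<lambda>x. \<zero>\<^bsub>M\<^esub>) \<in> lin_hom R L M"
  by (intro lin_homI) simp_all

lemma lin_hom_plus:
  assumes "f \<in> lin_hom R L M" "g \<in> lin_hom R L M"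
  shows "(\<lambda>x. f x \<oplus>\<^bsub>M\<^esub> g x) \<in> lin_hom R L M"
  using assms
  by (intro lin_homI) (simp_all add: lin_hom_closed lin_hom_add lin_hom_smult smult_r_distr M.a_ac)

lemma lin_hom_diff:
  assumes "f \<in> lin_hom R L M" "g \<in> lin_hom R L M"
  shows "(\<lambda>x. f x \<ominus>\<^bsub>M\<^esub> g x) \<in> lin_hom R L M"
  using assms
  by (intro lin_homI) (simp_all add: lin_hom_closed lin_hom_add lin_hom_smult smult_r_distr
     smult_r_minus a_minus_def M.a_ac M.minus_add)

lemma submoduleI:
  assumes "H \<subseteq> carrier M" "\<zero>\<^bsub>M\<^esub> \<in> H"
    and "\<And>x. x \<in> H \<Longrightarrow> \<ominus>\<^bsub>M\<^esub> x \<in> H"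
    and "\<And>x y. x \<in> H \<Longrightarrow> y \<in> H \<Longrightarrow> x \<oplus>\<^bsub>M\<^esub> y \<in> H"
    and "\<And>r x. r \<in> carrier R \<Longrightarrow> x \<in> H \<Longrightarrow> r \<odot>\<^bsub>M\<^esub> x \<in> H"
  shows "submodule H R M"
  using assms by (intro submodule.intro subgroup.intro) (simp_all add: a_inv_def submodule_axioms_def)

lemma submoduleD:
  assumes "submodule H R M"
  shows "H \<subseteq> carrier M" "\<zero>\<^bsub>M\<^esub> \<in> H"
    and "\<And>x. x \<in> H \<Longrightarrow> \<ominus>\<^bsub>M\<^esub> x \<in> H"
    and "\<And>x y. x \<in> H \<Longrightarrow> y \<in> H \<Longrightarrow> x \<oplus>\<^bsub>M\<^esub> y \<in> H"
    and "\<And>r x. r \<in> carrier R \<Longrightarrow> x \<in> H \<Longrightarrow> r \<odot>\<^bsub>M\<^esub> x \<in> H"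
proof -
  interpret additive_subgroup H M
    using assms by (simp add: additive_subgroup_def submodule_def)
  show "H \<subseteq> carrier M" "\<zero>\<^bsub>M\<^esub> \<in> H" by (simp_all add: a_subset)
  show "\<And>x. x \<in> H \<Longrightarrow> \<ominus>\<^bsub>M\<^esub> x \<in> H" "\<And>x y. x \<in> H \<Longrightarrow> y \<in> H \<Longrightarrow> x \<oplus>\<^bsub>M\<^esub> y \<in> H" by simp_all
  show "\<And>r x. r \<in> carrier R \<Longrightarrow> x \<in> H \<Longrightarrow> r \<odot>\<^bsub>M\<^esub> x \<in> H"
    using assms by (simp add: submodule.smult_closed)
qed

lemma submodule_is_left_module:
  assumes "submodule H R M"
  shows "left_module R (M\<lparr>carrier := H\<rparr>)"
proof -
  note H = submoduleD[OF assms]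
  have c: "\<And>x. x \<in> H \<Longrightarrow> x \<in> carrier M" using H(1) by auto
  have "abelian_group (M\<lparr>carrier := H\<rparr>)"
    using H by (intro abelian_groupI) (auto simp: c M.a_ac intro: M.l_neg M.r_neg)
  then show ?thesis
    using H R.ring_axioms
    by (intro left_module.intro left_module_axioms.intro)
      (auto simp: c smult_l_distr smult_r_distr smult_assoc)
qed

lemma abelian_subgroup_submodule: "submodule N R M \<Longrightarrow> abelian_subgroup N M"
  by (rule abelian_subgroupI3) (simp_all add: additive_subgroup_def submodule_def M.abelian_group_axioms)

end

section \<open>Coset calculus: quotient modules and maps induced on cosets\<close>

section \<open>Quotient modules\<close>

lemma quot_module_simps [simp]:
  "carrier (quot_module M N) = a_rcosets\<^bsub>M\<^esub> N"
  "\<zero>\<^bsub>quot_module M N\<^esub> = N"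
  "A \<oplus>\<^bsub>quot_module M N\<^esub> B = A <+>\<^bsub>M\<^esub> B"
  "r \<odot>\<^bsub>quot_module M N\<^esub> A = N <+>\<^bsub>M\<^esub> ((\<lambda>x. r \<odot>\<^bsub>M\<^esub> x) ` A)"
  by (simp_all add: quot_module_def)

lemma a_rcosets_iff: "A \<in> a_rcosets\<^bsub>M\<^esub> N \<longleftrightarrow> (\<exists>x\<in>carrier M. A = N +>\<^bsub>M\<^esub> x)"
  by (auto simp: A_RCOSETS_def')

text \<open>Only additivity of \<open>h\<close> is required, so that one computation serves both
  scalar multiplication on a quotient module (with \<open>h\<close> multiplication by a fixed
  scalar) and the map induced on homology.\<close>

lemma quot_map_coset:
  assumes "abelian_subgroup N M" "abelian_subgroup N' M'"
    and cl: "\<And>x. x \<in> carrier M \<Longrightarrow> h x \<in> carrier M'"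
    and add: "\<And>x y. x \<in> carrier M \<Longrightarrow> y \<in> carrier M \<Longrightarrow> h (x \<oplus>\<^bsub>M\<^esub> y) = h x \<oplus>\<^bsub>M'\<^esub> h y"
    and sub: "h ` N \<subseteq> N'" and x: "x \<in> carrier M"
  shows "N' <+>\<^bsub>M'\<^esub> (h ` (N +>\<^bsub>M\<^esub> x)) = N' +>\<^bsub>M'\<^esub> h x"
proof -
  interpret N: abelian_subgroup N M by fact
  interpret N': abelian_subgroup N' M' by fact
  have nc: "\<And>y. y \<in> N \<Longrightarrow> y \<in> carrier M" "\<And>y. y \<in> N' \<Longrightarrow> y \<in> carrier M'"
    using N.a_subset N'.a_subset by auto
  show ?thesis
  proof (intro equalityI subsetI)
    fix z assume "z \<in> N' <+>\<^bsub>M'\<^esub> (h ` (N +>\<^bsub>M\<^esub> x))"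
    then obtain n' n where n: "n' \<in> N'" "n \<in> N" "z = n' \<oplus>\<^bsub>M'\<^esub> h (n \<oplus>\<^bsub>M\<^esub> x)"
      by (auto simp: set_add_def' a_r_coset_def')
    then have "z = (n' \<oplus>\<^bsub>M'\<^esub> h n) \<oplus>\<^bsub>M'\<^esub> h x"
      using x sub by (simp add: add nc cl N'.a_assoc)
    moreover have "n' \<oplus>\<^bsub>M'\<^esub> h n \<in> N'" using n sub by auto
    ultimately show "z \<in> N' +>\<^bsub>M'\<^esub> h x" by (auto simp: a_r_coset_def')
  next
    fix z assume "z \<in> N' +>\<^bsub>M'\<^esub> h x"
    then obtain n' where "n' \<in> N'" "z = n' \<oplus>\<^bsub>M'\<^esub> h x" by (auto simp: a_r_coset_def')
    moreover have "x \<in> N +>\<^bsub>M\<^esub> x" using x by (rule N.a_rcos_self)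
    ultimately show "z \<in> N' <+>\<^bsub>M'\<^esub> (h ` (N +>\<^bsub>M\<^esub> x))" by (auto simp: set_add_def')
  qed
qed

lemma (in abelian_subgroup) a_rcos_eq_iff:
  assumes "x \<in> carrier G" "y \<in> carrier G"
  shows "H +> x = H +> y \<longleftrightarrow> x \<ominus> y \<in> H"
proof
  assume "H +> x = H +> y"
  then have "x \<in> H +> y" using a_rcos_self[OF assms(1)] by simp
  then show "x \<ominus> y \<in> H" using a_rcos_module[OF assms(2,1)] by (simp add: a_minus_def)
next
  assume "x \<ominus> y \<in> H"
  then have "x \<in> H +> y" using a_rcos_module[OF assms(2,1)] by (simp add: a_minus_def)
  then show "H +> x = H +> y" using a_repr_independence'[OF _ assms(2)] by simp
qed

lemma (in abelian_subgroup) a_rcos_eq_self_iff: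
  assumes "x \<in> carrier G"
  shows "H +> x = H \<longleftrightarrow> x \<in> H"
  using assms a_coset_join1 a_coset_join2 a_subgroup by blast

context left_module
begin

lemma quot_smult_coset:
  assumes N: "submodule N R M" and r: "r \<in> carrier R" "x \<in> carrier M"
  shows "N <+>\<^bsub>M\<^esub> ((\<lambda>x. r \<odot>\<^bsub>M\<^esub> x) ` (N +>\<^bsub>M\<^esub> x)) = N +>\<^bsub>M\<^esub> (r \<odot>\<^bsub>M\<^esub> x)"
  using submoduleD[OF N] r
  by (intro quot_map_coset abelian_subgroup_submodule[OF N]) (auto simp: smult_r_distr)

lemma quot_left_module:
  assumes N: "submodule N R M"
  shows "left_module R (quot_module M N)"
proof -
  interpret N: abelian_subgroup N M by (rule abelian_subgroup_submodule[OF N])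
  note [simp] = N.a_rcos_sum quot_smult_coset[OF N]
  have ex: "\<exists>y\<in>a_rcosets\<^bsub>M\<^esub> N. y <+>\<^bsub>M\<^esub> (N +>\<^bsub>M\<^esub> x) = N" if "x \<in> carrier M" for x
    using that
    by (intro bexI[of _ "N +>\<^bsub>M\<^esub> (\<ominus>\<^bsub>M\<^esub> x)"])
      (auto simp: M.l_neg a_rcosets_iff N.a_subset)
  have z: "N = N +>\<^bsub>M\<^esub> \<zero>\<^bsub>M\<^esub>" by (simp add: N.a_subset)
  have "abelian_group (quot_module M N)"
  proof (intro abelian_groupI)
    fix x assume "x \<in> carrier (quot_module M N)"
    then obtain a where a: "a \<in> carrier M" "x = N +>\<^bsub>M\<^esub> a" by (auto simp: a_rcosets_iff)
    then show "\<zero>\<^bsub>quot_module M N\<^esub> \<oplus>\<^bsub>quot_module M N\<^esub> x = x"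
      using N.rcosets_add_eq by (simp add: a_rcosets_iff) blast
  qed (use ex z in \<open>auto simp: a_rcosets_iff M.a_ac\<close>)
  then show ?thesis
    using R.ring_axioms
    by (intro left_module.intro left_module_axioms.intro)
      (auto simp: a_rcosets_iff smult_l_distr smult_r_distr smult_assoc)
qed

lemma quot_proj_lin:
  assumes N: "submodule N R M"
  shows "(\<lambda>x. N +>\<^bsub>M\<^esub> x) \<in> lin_hom R M (quot_module M N)"
proof -
  interpret N: abelian_subgroup N M by (rule abelian_subgroup_submodule[OF N])
  show ?thesis
    by (intro lin_homI) (auto simp: a_rcosets_iff N.a_rcos_sum quot_smult_coset[OF N])
qed

end

section \<open>The universal property of free modules\<close>

section \<open>Free modules\<close>

lemma free_module_simps [simp]:
  "f \<in> carrier (free_module R B) \<longleftrightarrow> (\<forall>x \<in> B. f x \<in> carrier R) \<and> (\<forall>x. x \<notin> B \<longrightarrow> f x = \<zero>\<^bsub>R\<^esub>) \<and>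
       finite {x. f x \<noteq> \<zero>\<^bsub>R\<^esub>}"
  "\<zero>\<^bsub>free_module R B\<^esub> = (\<lambda>x. \<zero>\<^bsub>R\<^esub>)"
  "f \<oplus>\<^bsub>free_module R B\<^esub> g = (\<lambda>x. f x \<oplus>\<^bsub>R\<^esub> g x)"
  "r \<odot>\<^bsub>free_module R B\<^esub> f = (\<lambda>x. r \<otimes>\<^bsub>R\<^esub> f x)"
  by (simp_all add: free_module_def)

lemma (in ring) free_left_module: "left_module R (free_module R B)"
proof -
  have fin: "finite {x. f x \<oplus> g x \<noteq> \<zero>}" if "finite {x. f x \<noteq> \<zero>}" "finite {x. g x \<noteq> \<zero>}" for f g :: "'c \<Rightarrow> 'a"
    by (rule finite_subset[OF _ finite_UnI[OF that]]) auto
  have fin': "finite {x. r \<otimes> f x \<noteq> \<zero>}" if "finite {x. f x \<noteq> \<zero>}" "r \<in> carrier R" for f :: "'c \<Rightarrow> 'a" and r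
    by (rule finite_subset[OF _ that(1)]) (use that in auto)
  have fin2: "finite {x. \<ominus> f x \<noteq> \<zero>}" if "finite {x. f x \<noteq> \<zero>}" for f :: "'c \<Rightarrow> 'a"
    by (rule finite_subset[OF _ that]) auto
  have cl: "f x \<in> carrier R" if "f \<in> carrier (free_module R B)" for f x
    using that by (cases "x \<in> B") auto
  have "abelian_group (free_module R B)"
  proof (intro abelian_groupI)
    fix f assume f: "f \<in> carrier (free_module R B)"
    show "\<exists>g\<in>carrier (free_module R B). g \<oplus>\<^bsub>free_module R B\<^esub> f = \<zero>\<^bsub>free_module R B\<^esub>"
      using f cl[OF f] by (intro bexI[of _ "\<lambda>x. \<ominus> f x"]) (auto simp: l_neg fin2)
    show "\<zero>\<^bsub>free_module R B\<^esub> \<oplus>\<^bsub>free_module R B\<^esub> f = f" using cl[OF f] by auto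
    fix g assume g: "g \<in> carrier (free_module R B)"
    show "f \<oplus>\<^bsub>free_module R B\<^esub> g \<in> carrier (free_module R B)" using f g by (simp add: fin)
    show "f \<oplus>\<^bsub>free_module R B\<^esub> g = g \<oplus>\<^bsub>free_module R B\<^esub> f" using cl[OF f] cl[OF g] by (auto simp: a_ac)
    fix h assume h: "h \<in> carrier (free_module R B)"
    show "f \<oplus>\<^bsub>free_module R B\<^esub> g \<oplus>\<^bsub>free_module R B\<^esub> h = f \<oplus>\<^bsub>free_module R B\<^esub> (g \<oplus>\<^bsub>free_module R B\<^esub> h)"
      using cl[OF f] cl[OF g] cl[OF h] by (auto simp: a_ac)
  qed simp
  then show ?thesis
    using ring_axioms
  proof (intro left_module.intro left_module_axioms.intro)
    fix f assume f: "f \<in> carrier (free_module R B)"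
    show "\<one> \<odot>\<^bsub>free_module R B\<^esub> f = f" using cl[OF f] by auto
    fix r assume r: "r \<in> carrier R"
    show "r \<odot>\<^bsub>free_module R B\<^esub> f \<in> carrier (free_module R B)" using f r by (simp add: fin')
    fix s assume s: "s \<in> carrier R"
    show "(r \<oplus> s) \<odot>\<^bsub>free_module R B\<^esub> f = r \<odot>\<^bsub>free_module R B\<^esub> f \<oplus>\<^bsub>free_module R B\<^esub> s \<odot>\<^bsub>free_module R B\<^esub> f"
      "(r \<otimes> s) \<odot>\<^bsub>free_module R B\<^esub> f = r \<odot>\<^bsub>free_module R B\<^esub> (s \<odot>\<^bsub>free_module R B\<^esub> f)"
      using r s cl[OF f] by (auto simp: l_distr m_assoc)
  next
    fix r f g assume r: "r \<in> carrier R" and f: "f \<in> carrier (free_module R B)"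
      and g: "g \<in> carrier (free_module R B)"
    show "r \<odot>\<^bsub>free_module R B\<^esub> (f \<oplus>\<^bsub>free_module R B\<^esub> g) =
        r \<odot>\<^bsub>free_module R B\<^esub> f \<oplus>\<^bsub>free_module R B\<^esub> r \<odot>\<^bsub>free_module R B\<^esub> g"
      using r cl[OF f] cl[OF g] by (auto simp: r_distr)
  qed
qed

text \<open>This is the linear extension of a choice \<open>e\<close> of images of the basis
  elements. Summing over the support of \<open>f\<close> keeps the sum finite even when the basis is
  infinite.\<close>

definition free_ext :: "('r, 'x) ring_scheme \<Rightarrow> ('r, 'm) module \<Rightarrow> ('b \<Rightarrow> 'm) \<Rightarrow> ('b \<Rightarrow> 'r) \<Rightarrow> 'm" where
  "free_ext R M e f = (\<Oplus>\<^bsub>M\<^esub>x\<in>{x. f x \<noteq> \<zero>\<^bsub>R\<^esub>}. f x \<odot>\<^bsub>M\<^esub> e x)"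

definition free_basis :: "('r, 'x) ring_scheme \<Rightarrow> 'b \<Rightarrow> 'b \<Rightarrow> 'r" where
  "free_basis R e = (\<lambda>x. if x = e then \<one>\<^bsub>R\<^esub> else \<zero>\<^bsub>R\<^esub>)"

lemma (in ring) free_basis_closed: "e \<in> B \<Longrightarrow> free_basis R e \<in> carrier (free_module R B)"
  by (auto simp: free_basis_def)

context left_module
begin

text \<open>Terms outside the support vanish, so the sum may be taken over any larger finite set.
  Additivity of \<open>free_ext\<close> uses this to put two functions and their sum over one index
  set.\<close>

lemma free_ext_eq:
  assumes "f \<in> carrier (free_module R B)" "e \<in> B \<rightarrow> carrier M"
    "finite S" "{x. f x \<noteq> \<zero>\<^bsub>R\<^esub>} \<subseteq> S" "S \<subseteq> B"
  shows "free_ext R M e f = (\<Oplus>\<^bsub>M\<^esub>x\<in>S. f x \<odot>\<^bsub>M\<^esub> e x)"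
  unfolding free_ext_def using assms
  by (intro M.add.finprod_mono_neutral_cong_left) (auto simp: Pi_iff subset_iff)

lemma free_ext_lin:
  assumes e: "e \<in> B \<rightarrow> carrier M"
  shows "free_ext R M e \<in> lin_hom R (free_module R B) M"
proof (intro lin_homI)
  interpret Fr: left_module R "free_module R B" by (rule R.free_left_module)
  have supp: "{x. f x \<noteq> \<zero>\<^bsub>R\<^esub>} \<subseteq> B" if "f \<in> carrier (free_module R B)" for f
    using that by auto
  fix f assume f: "f \<in> carrier (free_module R B)"
  define S where "S = {x. f x \<noteq> \<zero>\<^bsub>R\<^esub>}"
  have S: "finite S" "S \<subseteq> B" using f by (auto simp: S_def)
  have fS: "free_ext R M e f = (\<Oplus>\<^bsub>M\<^esub>x\<in>S. f x \<odot>\<^bsub>M\<^esub> e x)"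
    by (rule free_ext_eq[OF f e]) (use S in \<open>auto simp: S_def\<close>)
  have c: "(\<lambda>x. f x \<odot>\<^bsub>M\<^esub> e x) \<in> S \<rightarrow> carrier M" using S e f by (auto simp: Pi_iff)
  show "free_ext R M e f \<in> carrier M" unfolding fS by (rule M.finsum_closed[OF c])
  {
    fix r assume r: "r \<in> carrier R"
    have "free_ext R M e (r \<odot>\<^bsub>free_module R B\<^esub> f) = (\<Oplus>\<^bsub>M\<^esub>x\<in>S. (r \<odot>\<^bsub>free_module R B\<^esub> f) x \<odot>\<^bsub>M\<^esub> e x)"
      by (rule free_ext_eq[OF Fr.smult_closed[OF r f] e]) (use S r in \<open>auto simp: S_def\<close>)
    also have "\<dots> = (\<Oplus>\<^bsub>M\<^esub>x\<in>S. r \<odot>\<^bsub>M\<^esub> (f x \<odot>\<^bsub>M\<^esub> e x))"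
      using S e f r by (intro M.finsum_cong') (auto simp: Pi_iff smult_assoc subset_iff)
    also have "\<dots> = r \<odot>\<^bsub>M\<^esub> free_ext R M e f" unfolding fS by (rule smult_finsum[OF S(1) r c, symmetric])
    finally show "free_ext R M e (r \<odot>\<^bsub>free_module R B\<^esub> f) = r \<odot>\<^bsub>M\<^esub> free_ext R M e f" .
  }
  fix g assume g: "g \<in> carrier (free_module R B)"
  define T where "T = S \<union> {x. g x \<noteq> \<zero>\<^bsub>R\<^esub>}"
  have T: "finite T" "T \<subseteq> B" using f g S by (auto simp: T_def)
  have cT: "(\<lambda>x. f x \<odot>\<^bsub>M\<^esub> e x) \<in> T \<rightarrow> carrier M" "(\<lambda>x. g x \<odot>\<^bsub>M\<^esub> e x) \<in> T \<rightarrow> carrier M"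
    using T e f g by (auto simp: Pi_iff)
  have "free_ext R M e (f \<oplus>\<^bsub>free_module R B\<^esub> g) = (\<Oplus>\<^bsub>M\<^esub>x\<in>T. (f \<oplus>\<^bsub>free_module R B\<^esub> g) x \<odot>\<^bsub>M\<^esub> e x)"
    by (rule free_ext_eq[OF Fr.M.a_closed[OF f g] e]) (use T in \<open>auto simp: S_def T_def\<close>)
  also have "\<dots> = (\<Oplus>\<^bsub>M\<^esub>x\<in>T. f x \<odot>\<^bsub>M\<^esub> e x \<oplus>\<^bsub>M\<^esub> g x \<odot>\<^bsub>M\<^esub> e x)"
    using T e f g by (intro M.finsum_cong') (auto simp: Pi_iff smult_l_distr subset_iff)
  also have "\<dots> = (\<Oplus>\<^bsub>M\<^esub>x\<in>T. f x \<odot>\<^bsub>M\<^esub> e x) \<oplus>\<^bsub>M\<^esub> (\<Oplus>\<^bsub>M\<^esub>x\<in>T. g x \<odot>\<^bsub>M\<^esub> e x)"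
    using cT by (rule M.finsum_addf)
  also have "(\<Oplus>\<^bsub>M\<^esub>x\<in>T. f x \<odot>\<^bsub>M\<^esub> e x) = free_ext R M e f"
    by (rule free_ext_eq[OF f e, symmetric]) (use T in \<open>auto simp: S_def T_def\<close>)
  also have "(\<Oplus>\<^bsub>M\<^esub>x\<in>T. g x \<odot>\<^bsub>M\<^esub> e x) = free_ext R M e g"
    by (rule free_ext_eq[OF g e, symmetric]) (use T in \<open>auto simp: S_def T_def\<close>)
  finally show "free_ext R M e (f \<oplus>\<^bsub>free_module R B\<^esub> g) = free_ext R M e f \<oplus>\<^bsub>M\<^esub> free_ext R M e g" .
qed

lemma free_ext_basis:
  assumes e: "e \<in> B \<rightarrow> carrier M" and b: "b \<in> B"
  shows "free_ext R M e (free_basis R b) = e b"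
proof -
  have eb: "e b \<in> carrier M" using e b by auto
  have "free_ext R M e (free_basis R b) = (\<Oplus>\<^bsub>M\<^esub>x\<in>{b}. free_basis R b x \<odot>\<^bsub>M\<^esub> e x)"
    by (rule free_ext_eq[OF R.free_basis_closed[OF b] e]) (use b in \<open>auto simp: free_basis_def\<close>)
  also have "\<dots> = e b" using eb by (simp add: free_basis_def)
  finally show ?thesis .
qed

text \<open>The induction runs over a finite set containing the support. Each step clears the value
  of \<open>f\<close> at one point \<open>b\<close>, which splits off a multiple of a basis vector
  if \<open>b\<close> lies in \<open>B\<close> and changes nothing otherwise.\<close>

lemma lin_hom_free_eqI:
  assumes h: "h \<in> lin_hom R (free_module R B) M" "h' \<in> lin_hom R (free_module R B) M"
    and eq: "\<And>b. b \<in> B \<Longrightarrow> h (free_basis R b) = h' (free_basis R b)"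
    and f: "f \<in> carrier (free_module R B)"
  shows "h f = h' f"
proof -
  have Fr: "left_module R (free_module R B)" by (rule R.free_left_module)
  have "f \<in> carrier (free_module R B) \<Longrightarrow> {x. f x \<noteq> \<zero>\<^bsub>R\<^esub>} \<subseteq> S \<Longrightarrow> h f = h' f" if "finite S" for S f
    using that
  proof (induction S arbitrary: f rule: finite_induct)
    case empty
    then have "f = \<zero>\<^bsub>free_module R B\<^esub>" by auto
    then show ?case using lin_hom_zero[OF Fr left_module_axioms h(1)] lin_hom_zero[OF Fr left_module_axioms h(2)] by metis
  next
    case (insert b S)
    define g where "g = f(b := \<zero>\<^bsub>R\<^esub>)"
    have g: "g \<in> carrier (free_module R B)"
    proof -
      have "finite {x. g x \<noteq> \<zero>\<^bsub>R\<^esub>}"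
        by (rule finite_subset[of _ "{x. f x \<noteq> \<zero>\<^bsub>R\<^esub>}"]) (use insert.prems in \<open>auto simp: g_def\<close>)
      then show ?thesis using insert.prems by (auto simp: g_def)
    qed
    have "{x. g x \<noteq> \<zero>\<^bsub>R\<^esub>} \<subseteq> S" using insert.prems by (auto simp: g_def)
    then have IH: "h g = h' g" using insert.IH g by blast
    show ?case
    proof (cases "b \<in> B")
      case True
      let ?t = "f b \<odot>\<^bsub>free_module R B\<^esub> free_basis R b"
      have fb: "f b \<in> carrier R" using True insert.prems by auto
      have bc: "free_basis R b \<in> carrier (free_module R B)" using True by (rule R.free_basis_closed)
      have tc: "?t \<in> carrier (free_module R B)" using Fr fb bc by (rule left_module.smult_closed)
      have "f x \<in> carrier R" for x using insert.prems(1) by (cases "x \<in> B") auto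
      then have dec: "f = g \<oplus>\<^bsub>free_module R B\<^esub> ?t"
        by (auto simp: g_def free_basis_def fun_eq_iff)
      have "h f = h g \<oplus>\<^bsub>M\<^esub> f b \<odot>\<^bsub>M\<^esub> h (free_basis R b)"
        by (subst dec) (simp only: lin_hom_add[OF h(1) g tc] lin_hom_smult[OF h(1) fb bc])
      moreover have "h' f = h' g \<oplus>\<^bsub>M\<^esub> f b \<odot>\<^bsub>M\<^esub> h' (free_basis R b)"
        by (subst dec) (simp only: lin_hom_add[OF h(2) g tc] lin_hom_smult[OF h(2) fb bc])
      ultimately show ?thesis by (simp add: IH eq True)
    next
      case False
      then have "f = g" using insert.prems by (auto simp: g_def)
      then show ?thesis using IH by simp
    qed
  qed
  then show ?thesis using f by auto
qed

end

section \<open>Projective modules: lifting, retracts, splittings and extensions\<close>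

section \<open>Projective modules\<close>

lemma projective_left_module: "projective R M \<Longrightarrow> left_module R M"
  by (simp add: projective_def)

text \<open>This is the lifting property for the map \<open>p1 + p2\<close> out of the direct sum of
  \<open>A1\<close> and \<open>A2\<close>, phrased so that the sum need not be formed. Preimages are
  chosen on the basis of the free module, extended linearly, and pulled back along \<open>s\<close>.
  The two-term form is needed to write a cycle as the image of a cycle plus a boundary, linearly in
  a parameter.\<close>

lemma projective_lift2:
  fixes M :: "('r, 'm) module"
  assumes M: "projective R M" and A1: "left_module R A1" and A2: "left_module R A2"
    and N: "left_module R N"
    and p1: "p1 \<in> lin_hom R A1 N" and p2: "p2 \<in> lin_hom R A2 N" and t: "t \<in> lin_hom R M N"
    and ex: "\<And>x. x \<in> carrier M \<Longrightarrow> \<exists>a1\<in>carrier A1. \<exists>a2\<in>carrier A2. t x = p1 a1 \<oplus>\<^bsub>N\<^esub> p2 a2"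
  obtains v1 v2 where "v1 \<in> lin_hom R M A1" "v2 \<in> lin_hom R M A2"
    "\<And>x. x \<in> carrier M \<Longrightarrow> t x = p1 (v1 x) \<oplus>\<^bsub>N\<^esub> p2 (v2 x)"
proof -
  interpret A1: left_module R A1 by fact
  interpret A2: left_module R A2 by fact
  interpret N: left_module R N by fact
  obtain B :: "'m set" and s p where s: "s \<in> lin_hom R M (free_module R B)" and p: "p \<in> lin_hom R (free_module R B) M"
    and ps: "\<And>x. x \<in> carrier M \<Longrightarrow> p (s x) = x"
    using M unfolding projective_def by blast
  have "\<exists>a1 a2. a1 \<in> carrier A1 \<and> a2 \<in> carrier A2 \<and> t (p (free_basis R b)) = p1 a1 \<oplus>\<^bsub>N\<^esub> p2 a2" if "b \<in> B" for b
    using ex[OF lin_hom_closed[OF p A1.R.free_basis_closed[OF that]]] by blast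
  then obtain c1 c2 where c: "\<And>b. b \<in> B \<Longrightarrow> c1 b \<in> carrier A1 \<and> c2 b \<in> carrier A2 \<and> t (p (free_basis R b)) = p1 (c1 b) \<oplus>\<^bsub>N\<^esub> p2 (c2 b)"
    by metis
  have c1: "c1 \<in> B \<rightarrow> carrier A1" and c2: "c2 \<in> B \<rightarrow> carrier A2" using c by auto
  have "t (p f) = p1 (free_ext R A1 c1 f) \<oplus>\<^bsub>N\<^esub> p2 (free_ext R A2 c2 f)"
    if "f \<in> carrier (free_module R B)" for f
    by (rule N.lin_hom_free_eqI[OF lin_hom_comp[OF p t]
        N.lin_hom_plus[OF lin_hom_comp[OF A1.free_ext_lin[OF c1] p1] lin_hom_comp[OF A2.free_ext_lin[OF c2] p2]] _ that])
      (simp add: A1.free_ext_basis[OF c1] A2.free_ext_basis[OF c2] c)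
  from this[OF lin_hom_closed[OF s]]
  have "t x = p1 (free_ext R A1 c1 (s x)) \<oplus>\<^bsub>N\<^esub> p2 (free_ext R A2 c2 (s x))" if "x \<in> carrier M" for x
    using that by (simp add: ps)
  then show ?thesis
    by (rule that[OF lin_hom_comp[OF s A1.free_ext_lin[OF c1]] lin_hom_comp[OF s A2.free_ext_lin[OF c2]]])
qed

text \<open>The usual lifting property, obtained from the two-term version by taking the second map
  to be zero.\<close>

lemma projective_lift:
  assumes M: "projective R M" and A: "left_module R A" and N: "left_module R N"
    and p: "p \<in> lin_hom R A N" and t: "t \<in> lin_hom R M N"
    and ex: "\<And>x. x \<in> carrier M \<Longrightarrow> \<exists>a\<in>carrier A. t x = p a"
  obtains v where "v \<in> lin_hom R M A" "\<And>x. x \<in> carrier M \<Longrightarrow> t x = p (v x)"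
proof -
  interpret A: left_module R A by fact
  interpret N: left_module R N by fact
  have ex': "\<exists>a1\<in>carrier A. \<exists>a2\<in>carrier A. t x = p a1 \<oplus>\<^bsub>N\<^esub> \<zero>\<^bsub>N\<^esub>" if "x \<in> carrier M" for x
    using ex[OF that] lin_hom_closed[OF p] by (metis N.M.r_zero)
  obtain v1 v2 where v: "v1 \<in> lin_hom R M A" "\<And>x. x \<in> carrier M \<Longrightarrow> t x = p (v1 x) \<oplus>\<^bsub>N\<^esub> \<zero>\<^bsub>N\<^esub>"
    using projective_lift2[OF M A A N p N.lin_hom_zero_map t ex'] by blast
  show ?thesis
    by (rule that[OF v(1)]) (simp add: v lin_hom_closed[OF p] lin_hom_closed[OF v(1)])
qed

lemma projectiveI:
  assumes M: "left_module R M" and s: "s \<in> lin_hom R M (free_module R (carrier M))"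
    and "\<And>x. x \<in> carrier M \<Longrightarrow> free_ext R M (\<lambda>x. x) (s x) = x"
  shows "projective R M"
  unfolding projective_def
  using assms left_module.free_ext_lin[OF M, of "\<lambda>x. x" "carrier M"] by blast

lemma (in left_module) free_ext_surj:
  assumes "x \<in> carrier M"
  shows "\<exists>a\<in>carrier (free_module R (carrier M)). x = free_ext R M (\<lambda>x. x) a"
  using assms R.free_basis_closed[OF assms] free_ext_basis[of "\<lambda>x. x" "carrier M" x] by force

text \<open>A basis for \<open>P\<close> lives in the wrong type. Lifting \<open>r\<close> through
  the canonical map from the free module on \<open>carrier M\<close> and composing with
  \<open>s\<close> gives a section over a basis inside \<open>M\<close>.\<close>

lemma projective_retract:
  assumes P: "projective R P" and M: "left_module R M"
    and s: "s \<in> lin_hom R M P" and r: "r \<in> lin_hom R P M"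
    and rs: "\<And>x. x \<in> carrier M \<Longrightarrow> r (s x) = x"
  shows "projective R M"
proof -
  interpret M: left_module R M by fact
  have pi: "free_ext R M (\<lambda>x. x) \<in> lin_hom R (free_module R (carrier M)) M"
    by (rule M.free_ext_lin) simp
  obtain v where v: "v \<in> lin_hom R P (free_module R (carrier M))"
    "\<And>x. x \<in> carrier P \<Longrightarrow> r x = free_ext R M (\<lambda>x. x) (v x)"
    using projective_lift[OF P M.R.free_left_module M pi r M.free_ext_surj[OF lin_hom_closed[OF r]]] by blast
  show ?thesis
    by (rule projectiveI[OF M lin_hom_comp[OF s v(1)]]) (metis v(2) rs lin_hom_closed[OF s])
qed

text \<open>The section is a lift of the identity of the quotient through the canonical
  projection.\<close>

lemma projective_quot_section:
  assumes M: "left_module R M" and N: "submodule N R M" and Q: "projective R (quot_module M N)"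
  obtains s where "s \<in> lin_hom R (quot_module M N) M"
    "\<And>x. x \<in> carrier M \<Longrightarrow> x \<ominus>\<^bsub>M\<^esub> s (N +>\<^bsub>M\<^esub> x) \<in> N"
proof -
  interpret M: left_module R M by fact
  interpret N: abelian_subgroup N M by (rule M.abelian_subgroup_submodule[OF N])
  obtain s where s: "s \<in> lin_hom R (quot_module M N) M"
    "\<And>A. A \<in> carrier (quot_module M N) \<Longrightarrow> A = N +>\<^bsub>M\<^esub> s A"
    by (rule projective_lift[OF Q M projective_left_module[OF Q] M.quot_proj_lin[OF N] lin_hom_id])
      (auto simp: a_rcosets_iff)
  show ?thesis
  proof (rule that[OF s(1)])
    fix x assume x: "x \<in> carrier M"
    then have q: "N +>\<^bsub>M\<^esub> x \<in> carrier (quot_module M N)" by (auto simp: a_rcosets_iff)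
    show "x \<ominus>\<^bsub>M\<^esub> s (N +>\<^bsub>M\<^esub> x) \<in> N"
      using s(2)[OF q] N.a_rcos_eq_iff[OF x lin_hom_closed[OF s(1) q]] by simp
  qed
qed

text \<open>A section \<open>s\<close> of the projection splits the inclusion of \<open>N\<close>:
  the complementary component of \<open>x\<close> is \<open>x\<close> minus \<open>s\<close> of its
  coset.\<close>

lemma projective_quot_retraction:
  assumes M: "left_module R M" and N: "submodule N R M" and Q: "projective R (quot_module M N)"
  obtains s \<rho> where "s \<in> lin_hom R (quot_module M N) M" "\<rho> \<in> lin_hom R M (M\<lparr>carrier := N\<rparr>)"
    "\<And>x. x \<in> N \<Longrightarrow> \<rho> x = x" "\<And>x. x \<in> carrier M \<Longrightarrow> s (N +>\<^bsub>M\<^esub> x) \<oplus>\<^bsub>M\<^esub> \<rho> x = x"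
proof -
  interpret M: left_module R M by fact
  interpret N: abelian_subgroup N M by (rule M.abelian_subgroup_submodule[OF N])
  obtain s where s: "s \<in> lin_hom R (quot_module M N) M"
    "\<And>x. x \<in> carrier M \<Longrightarrow> x \<ominus>\<^bsub>M\<^esub> s (N +>\<^bsub>M\<^esub> x) \<in> N"
    by (rule projective_quot_section[OF assms]) blast
  let ?r = "\<lambda>x. x \<ominus>\<^bsub>M\<^esub> s (N +>\<^bsub>M\<^esub> x)"
  note sc = lin_hom_comp[OF M.quot_proj_lin[OF N] s(1)]
  have r: "?r \<in> lin_hom R M (M\<lparr>carrier := N\<rparr>)"
    by (rule lin_hom_corestrict[OF M.lin_hom_diff[OF lin_hom_id sc] s(2)])
  show ?thesis
  proof (rule that[OF s(1) r])
    fix x assume x: "x \<in> N"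
    then have xM: "x \<in> carrier M" using N.a_subset by auto
    have "N +>\<^bsub>M\<^esub> x = \<zero>\<^bsub>quot_module M N\<^esub>" using x xM by (simp add: N.a_rcos_eq_self_iff)
    then have "s (N +>\<^bsub>M\<^esub> x) = \<zero>\<^bsub>M\<^esub>"
      using lin_hom_zero[OF projective_left_module[OF Q] M s(1)] by simp
    then show "?r x = x" using xM by (simp add: a_minus_def)
  next
    fix x assume x: "x \<in> carrier M"
    then show "s (N +>\<^bsub>M\<^esub> x) \<oplus>\<^bsub>M\<^esub> ?r x = x"
      using lin_hom_closed[OF sc x] by (simp add: a_minus_def M.a_lcomm M.r_neg)
  qed
qed

text \<open>Both the section \<open>s\<close> of the quotient and the inclusion of \<open>N\<close>
  lift through the canonical map from the free module on \<open>carrier M\<close>. As every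
  \<open>x\<close> is the sum of its two components, adding the lifts yields a section on all of
  \<open>M\<close>.\<close>

lemma projective_extension:
  assumes M: "left_module R M" and N: "submodule N R M"
    and PN: "projective R (M\<lparr>carrier := N\<rparr>)" and Q: "projective R (quot_module M N)"
  shows "projective R M"
proof -
  interpret M: left_module R M by fact
  interpret Fr: left_module R "free_module R (carrier M)" by (rule M.R.free_left_module)
  let ?pi = "free_ext R M (\<lambda>x. x)"
  have pi: "?pi \<in> lin_hom R (free_module R (carrier M)) M"
    by (rule M.free_ext_lin) simp
  obtain s \<rho> where s: "s \<in> lin_hom R (quot_module M N) M" and r: "\<rho> \<in> lin_hom R M (M\<lparr>carrier := N\<rparr>)"
    and sr: "\<And>x. x \<in> carrier M \<Longrightarrow> s (N +>\<^bsub>M\<^esub> x) \<oplus>\<^bsub>M\<^esub> \<rho> x = x"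
    by (rule projective_quot_retraction[OF M N Q]) blast
  obtain v where v: "v \<in> lin_hom R (quot_module M N) (free_module R (carrier M))"
    "\<And>x. x \<in> carrier (quot_module M N) \<Longrightarrow> s x = ?pi (v x)"
    using projective_lift[OF Q Fr.left_module_axioms M pi s M.free_ext_surj[OF lin_hom_closed[OF s]]] by blast
  have NM: "N \<subseteq> carrier M" using N M.submoduleD by blast
  obtain w where w: "w \<in> lin_hom R (M\<lparr>carrier := N\<rparr>) (free_module R (carrier M))"
    "\<And>x. x \<in> carrier (M\<lparr>carrier := N\<rparr>) \<Longrightarrow> x = ?pi (w x)"
    by (rule projective_lift[OF PN Fr.left_module_axioms M pi lin_hom_restrict[OF lin_hom_id NM] M.free_ext_surj])
      (use NM in auto)
  note pr = M.quot_proj_lin[OF N]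
  show ?thesis
  proof (rule projectiveI[OF M Fr.lin_hom_plus[OF lin_hom_comp[OF pr v(1)] lin_hom_comp[OF r w(1)]]])
    fix x assume x: "x \<in> carrier M"
    note q = lin_hom_closed[OF pr x] and n = lin_hom_closed[OF r x]
    show "?pi (v (N +>\<^bsub>M\<^esub> x) \<oplus>\<^bsub>free_module R (carrier M)\<^esub> w (\<rho> x)) = x"
      by (simp only: lin_hom_add[OF pi lin_hom_closed[OF v(1) q] lin_hom_closed[OF w(1) n]]
         v(2)[OF q, symmetric] w(2)[OF n, symmetric] sr[OF x])
  qed
qed

text \<open>The map taking \<open>x\<close> to \<open>x\<close> minus \<open>h x\<close> kills
  \<open>N\<close>, so it descends to the quotient. There it is a section of the projection because
  \<open>h x\<close> lies in \<open>N\<close>, and the quotient becomes a retract of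
  \<open>M\<close>.\<close>

lemma projective_quot_of_retraction:
  assumes P: "projective R M" and N: "submodule N R M"
    and h: "h \<in> lin_hom R M M" "\<And>x. x \<in> carrier M \<Longrightarrow> h x \<in> N" "\<And>x. x \<in> N \<Longrightarrow> h x = x"
  shows "projective R (quot_module M N)"
proof -
  note M = projective_left_module[OF P]
  interpret M: left_module R M by fact
  interpret N: abelian_subgroup N M by (rule M.abelian_subgroup_submodule[OF N])
  \<comment> \<open>A representative of the coset is chosen arbitrarily; the next fact shows that
    the choice does not affect the value.\<close>
  define s where "s A = (let x = SOME x. x \<in> carrier M \<and> A = N +>\<^bsub>M\<^esub> x in x \<ominus>\<^bsub>M\<^esub> h x)" for A
  have s: "s (N +>\<^bsub>M\<^esub> x) = x \<ominus>\<^bsub>M\<^esub> h x" if x: "x \<in> carrier M" for x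
  proof -
    define y where "y = (SOME y. y \<in> carrier M \<and> N +>\<^bsub>M\<^esub> x = N +>\<^bsub>M\<^esub> y)"
    have y: "y \<in> carrier M \<and> N +>\<^bsub>M\<^esub> x = N +>\<^bsub>M\<^esub> y"
      unfolding y_def by (rule someI[of _ x]) (use x in auto)
    then have z: "y \<ominus>\<^bsub>M\<^esub> x \<in> N" using N.a_rcos_eq_iff[of y x] x by auto
    have hc: "h x \<in> carrier M" using lin_hom_closed[OF h(1) x] .
    have yd: "y = (y \<ominus>\<^bsub>M\<^esub> x) \<oplus>\<^bsub>M\<^esub> x" using x y by (simp add: a_minus_def M.M.a_assoc M.M.l_neg)
    then have hy: "h y = (y \<ominus>\<^bsub>M\<^esub> x) \<oplus>\<^bsub>M\<^esub> h x"
      using lin_hom_add[OF h(1), of "y \<ominus>\<^bsub>M\<^esub> x" x] x y h(3)[OF z] by simp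
    \<comment> \<open>Here \<open>z\<close> stands for the difference \<open>y - x\<close> of two
      representatives, an element of \<open>N\<close> and hence fixed by \<open>h\<close>.\<close>
    have "(z \<oplus>\<^bsub>M\<^esub> x) \<ominus>\<^bsub>M\<^esub> (z \<oplus>\<^bsub>M\<^esub> h x) = x \<ominus>\<^bsub>M\<^esub> h x" if "z \<in> carrier M" for z
    proof -
      have "(z \<oplus>\<^bsub>M\<^esub> x) \<ominus>\<^bsub>M\<^esub> (z \<oplus>\<^bsub>M\<^esub> h x) = (z \<oplus>\<^bsub>M\<^esub> \<ominus>\<^bsub>M\<^esub> z) \<oplus>\<^bsub>M\<^esub> (x \<ominus>\<^bsub>M\<^esub> h x)"
        using x hc that by (simp add: a_minus_def M.M.minus_add M.M.a_ac)
      then show ?thesis using x hc that by (simp add: M.M.r_neg)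
    qed
    from this[of "y \<ominus>\<^bsub>M\<^esub> x"]
    have "y \<ominus>\<^bsub>M\<^esub> h y = x \<ominus>\<^bsub>M\<^esub> h x" using x y hy yd by simp
    then show ?thesis by (simp add: s_def y_def[symmetric] Let_def)
  qed
  show ?thesis
  proof (rule projective_retract[OF P M.quot_left_module[OF N] _ M.quot_proj_lin[OF N]])
    note hd = M.lin_hom_diff[OF lin_hom_id h(1)]
    show "s \<in> lin_hom R (quot_module M N) M"
      by (intro lin_homI)
        (auto simp: a_rcosets_iff s N.a_rcos_sum M.quot_smult_coset[OF N] lin_hom_closed[OF hd] lin_hom_add[OF hd] lin_hom_smult[OF hd])
    fix A assume "A \<in> carrier (quot_module M N)"
    then obtain x where x: "x \<in> carrier M" "A = N +>\<^bsub>M\<^esub> x" by (auto simp: a_rcosets_iff)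
    have "(x \<ominus>\<^bsub>M\<^esub> h x) \<ominus>\<^bsub>M\<^esub> x = \<ominus>\<^bsub>M\<^esub> h x"
      using x lin_hom_closed[OF h(1)] by (simp add: a_minus_def M.a_ac M.M.r_neg2)
    then show "N +>\<^bsub>M\<^esub> s A = A"
      using x h(2) lin_hom_closed[OF h(1)] N.a_rcos_eq_iff[of "x \<ominus>\<^bsub>M\<^esub> h x" x] by (simp add: s)
  qed
qed

section \<open>Chain maps, cycles, boundaries and homology\<close>

section \<open>Complexes\<close>

lemma complex_left_module: "is_complex R C \<Longrightarrow> left_module R (obj C i)"
  by (simp add: is_complex_def)

lemma complex_diff_lin: "is_complex R C \<Longrightarrow> diff C i \<in> lin_hom R (obj C i) (obj C (i - 1))"
  by (simp add: is_complex_def)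

text \<open>Indexing by \<open>i + 1\<close> makes the target literally \<open>obj C i\<close>, so
  that later types of maps match without rewriting \<open>i + 1 - 1\<close>. The same purpose is
  served by the other \<open>_Suc\<close> facts.\<close>

lemma complex_diff_lin_Suc: "is_complex R C \<Longrightarrow> diff C (i + 1) \<in> lin_hom R (obj C (i + 1)) (obj C i)"
  using complex_diff_lin[of R C "i + 1"] by simp

lemma complex_diff_diff_Suc:
  assumes "is_complex R C" "x \<in> carrier (obj C (i + 1))"
  shows "diff C i (diff C (i + 1) x) = \<zero>\<^bsub>obj C (i - 1)\<^esub>"
proof -
  have "\<forall>x \<in> carrier (obj C (i + 1)). diff C (i + 1 - 1) (diff C (i + 1) x) = \<zero>\<^bsub>obj C (i + 1 - 1 - 1)\<^esub>"
    using assms(1) unfolding is_complex_def by blast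
  then show ?thesis using assms(2) by simp
qed

lemma chain_map_lin: "chain_map R C D f \<Longrightarrow> f i \<in> lin_hom R (obj C i) (obj D i)"
  by (simp add: chain_map_def)

lemma chain_map_diff_Suc:
  assumes "chain_map R C D f" "x \<in> carrier (obj C (i + 1))"
  shows "f i (diff C (i + 1) x) = diff D (i + 1) (f (i + 1) x)"
proof -
  have "\<forall>x \<in> carrier (obj C (i + 1)). f (i + 1 - 1) (diff C (i + 1) x) = diff D (i + 1) (f (i + 1) x)"
    using assms(1) unfolding chain_map_def by blast
  then show ?thesis using assms(2) by simp
qed

lemma chain_map_diff:
  "chain_map R C D f \<Longrightarrow> x \<in> carrier (obj C i) \<Longrightarrow> f (i - 1) (diff C i x) = diff D i (f i x)"
  by (simp add: chain_map_def)

lemma chain_map_comp: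
  assumes "chain_map R C D f" "chain_map R D E g"
  shows "chain_map R C E (\<lambda>i x. g i (f i x))"
  unfolding chain_map_def
proof (intro conjI allI ballI)
  show "(\<lambda>x. g i (f i x)) \<in> lin_hom R (obj C i) (obj E i)" for i
    by (rule lin_hom_comp[OF chain_map_lin[OF assms(1)] chain_map_lin[OF assms(2)]])
  show "g (i - 1) (f (i - 1) (diff C i x)) = diff E i (g i (f i x))" if "x \<in> carrier (obj C i)" for i x
    using chain_map_diff[OF assms(1) that]
      chain_map_diff[OF assms(2) lin_hom_closed[OF chain_map_lin[OF assms(1)] that]] by simp
qed

lemma cycles_iff: "x \<in> cycles C i \<longleftrightarrow> x \<in> carrier (obj C i) \<and> diff C i x = \<zero>\<^bsub>obj C (i - 1)\<^esub>"
  by (auto simp: cycles_def a_kernel_def kernel_def)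

lemma boundaries_iff: "x \<in> boundaries C i \<longleftrightarrow> (\<exists>z\<in>carrier (obj C (i + 1)). x = diff C (i + 1) z)"
  by (auto simp: boundaries_def)

lemma cycles_submodule:
  assumes C: "is_complex R C" shows "submodule (cycles C i) R (obj C i)"
proof -
  note m = complex_left_module[OF C] and d = complex_diff_lin[OF C, of i]
  interpret M: left_module R "obj C i" by (rule m)
  interpret N: left_module R "obj C (i - 1)" by (rule m)
  interpret h: abelian_group_hom "obj C i" "obj C (i - 1)" "diff C i"
    by (rule lin_hom_abelian_group_hom[OF m m d])
  show ?thesis
    by (rule M.submoduleI) (auto simp: cycles_iff lin_hom_add[OF d] lin_hom_smult[OF d])
qed

lemma boundaries_subset_cycles:
  assumes C: "is_complex R C" shows "boundaries C i \<subseteq> cycles C i"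
  using complex_diff_diff_Suc[OF C, of _ i] lin_hom_closed[OF complex_diff_lin_Suc[OF C, of i]]
  by (auto simp: boundaries_iff cycles_iff)

lemma boundaries_submodule:
  assumes C: "is_complex R C" shows "submodule (boundaries C i) R (obj C i)"
proof -
  note m = complex_left_module[OF C] and d = complex_diff_lin_Suc[OF C, of i]
  interpret M: left_module R "obj C i" by (rule m)
  interpret N: left_module R "obj C (i + 1)" by (rule m)
  interpret h: abelian_group_hom "obj C (i + 1)" "obj C i" "diff C (i + 1)"
    by (rule lin_hom_abelian_group_hom[OF m m d])
  show ?thesis
  proof (rule M.submoduleI)
    show "boundaries C i \<subseteq> carrier (obj C i)" by (auto simp: boundaries_iff)
    show "\<zero>\<^bsub>obj C i\<^esub> \<in> boundaries C i" using h.hom_zero by (force simp: boundaries_iff)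
    show "\<ominus>\<^bsub>obj C i\<^esub> x \<in> boundaries C i" if "x \<in> boundaries C i" for x
      using that by (auto simp: boundaries_iff simp flip: h.hom_a_inv)
    show "x \<oplus>\<^bsub>obj C i\<^esub> y \<in> boundaries C i" if "x \<in> boundaries C i" "y \<in> boundaries C i" for x y
      using that by (auto simp: boundaries_iff simp flip: h.hom_add)
    show "r \<odot>\<^bsub>obj C i\<^esub> x \<in> boundaries C i" if "r \<in> carrier R" "x \<in> boundaries C i" for r x
      using that by (auto simp: boundaries_iff simp flip: lin_hom_smult[OF d])
  qed
qed

lemma homology_carrier:
  "carrier (homology C i) = {boundaries C i +>\<^bsub>obj C i\<^esub> x |x. x \<in> cycles C i}"
  by (simp add: homology_def A_RCOSETS_def' a_r_coset_def' set_eq_iff image_iff) blast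

text \<open>In a zero homology module the coset of a cycle must equal the zero coset, which is the
  set of boundaries.\<close>

lemma zero_homologyD:
  assumes C: "is_complex R C" and z: "zero_module (homology C i)" and x: "x \<in> cycles C i"
  shows "x \<in> boundaries C i"
proof -
  interpret B: abelian_subgroup "boundaries C i" "obj C i"
    by (rule left_module.abelian_subgroup_submodule[OF complex_left_module[OF C] boundaries_submodule[OF C]])
  have "boundaries C i +>\<^bsub>obj C i\<^esub> x \<in> carrier (homology C i)" using x by (auto simp: homology_carrier)
  then have "boundaries C i +>\<^bsub>obj C i\<^esub> x = boundaries C i"
    using z by (simp add: zero_module_def homology_def)
  then show ?thesis using x B.a_rcos_eq_self_iff by (simp add: cycles_iff)
qed

section \<open>Quasi-isomorphisms in terms of elements\<close>

section \<open>Quasi-isomorphisms\<close>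

text \<open>An element-level form of a quasi-isomorphism: the last two clauses express injectivity
  and surjectivity on homology without cosets. This shape feeds directly into lifting
  arguments.\<close>

definition weak_equiv ::
    "('r, 'x) ring_scheme \<Rightarrow> ('r, 'm) cplx \<Rightarrow> ('r, 'n) cplx \<Rightarrow> (int \<Rightarrow> 'm \<Rightarrow> 'n) \<Rightarrow> bool" where
  "weak_equiv R C D f \<longleftrightarrow> is_complex R C \<and> is_complex R D \<and> chain_map R C D f \<and>
     (\<forall>i. \<forall>x \<in> cycles C i. f i x \<in> boundaries D i \<longrightarrow> x \<in> boundaries C i) \<and>
     (\<forall>i. \<forall>y \<in> cycles D i. \<exists>x \<in> cycles C i. \<exists>w \<in> carrier (obj D (i + 1)).
        y = f i x \<oplus>\<^bsub>obj D i\<^esub> diff D (i + 1) w)"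

lemma weak_equivD:
  assumes "weak_equiv R C D f"
  shows "is_complex R C" "is_complex R D" "chain_map R C D f"
    and "\<And>i x. x \<in> cycles C i \<Longrightarrow> f i x \<in> boundaries D i \<Longrightarrow> x \<in> boundaries C i"
    and "\<And>i y. y \<in> cycles D i \<Longrightarrow> \<exists>x \<in> cycles C i. \<exists>w \<in> carrier (obj D (i + 1)).
        y = f i x \<oplus>\<^bsub>obj D i\<^esub> diff D (i + 1) w"
  using assms by (auto simp: weak_equiv_def)

lemma chain_map_cycles:
  assumes C: "is_complex R C" and D: "is_complex R D" and f: "chain_map R C D f" and x: "x \<in> cycles C i"
  shows "f i x \<in> cycles D i"
  using x lin_hom_closed[OF chain_map_lin[OF f]] chain_map_diff[OF f, of x i, symmetric]
    lin_hom_zero[OF complex_left_module[OF C] complex_left_module[OF D] chain_map_lin[OF f]]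
  by (simp add: cycles_iff)

lemma chain_map_boundaries:
  assumes f: "chain_map R C D f" and x: "x \<in> boundaries C i"
  shows "f i x \<in> boundaries D i"
  using x lin_hom_closed[OF chain_map_lin[OF f]] chain_map_diff_Suc[OF f]
  by (force simp: boundaries_iff)

lemma quasi_iso_weak_equiv:
  assumes "quasi_iso R C D f"
  shows "weak_equiv R C D f"
proof -
  have C: "is_complex R C" and D: "is_complex R D" and f: "chain_map R C D f"
    and bij: "\<And>i. bij_betw (homology_map D f i) (carrier (homology C i)) (carrier (homology D i))"
    using assms by (auto simp: quasi_iso_def)
  have BC: "abelian_subgroup (boundaries C i) (obj C i)" for i
    by (rule left_module.abelian_subgroup_submodule[OF complex_left_module[OF C] boundaries_submodule[OF C]])
  have BD: "abelian_subgroup (boundaries D i) (obj D i)" for i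
    by (rule left_module.abelian_subgroup_submodule[OF complex_left_module[OF D] boundaries_submodule[OF D]])
  have hm: "homology_map D f i (boundaries C i +>\<^bsub>obj C i\<^esub> x) = boundaries D i +>\<^bsub>obj D i\<^esub> f i x"
    if "x \<in> carrier (obj C i)" for i x
    unfolding homology_map_def quot_map_def
    by (rule quot_map_coset[OF BC BD _ _ _ that])
      (use lin_hom_closed[OF chain_map_lin[OF f]] lin_hom_add[OF chain_map_lin[OF f]]
        chain_map_boundaries[OF f] in auto)
  have "x \<in> boundaries C i" if x: "x \<in> cycles C i" and fx: "f i x \<in> boundaries D i" for i x
  proof -
    interpret BC: abelian_subgroup "boundaries C i" "obj C i" by (rule BC)
    interpret BD: abelian_subgroup "boundaries D i" "obj D i" by (rule BD)
    have xc: "x \<in> carrier (obj C i)" and fxc: "f i x \<in> carrier (obj D i)"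
      using x lin_hom_closed[OF chain_map_lin[OF f]] by (auto simp: cycles_iff)
    have f0: "f i \<zero>\<^bsub>obj C i\<^esub> = \<zero>\<^bsub>obj D i\<^esub>"
      by (rule lin_hom_zero[OF complex_left_module[OF C] complex_left_module[OF D] chain_map_lin[OF f]])
    have "\<zero>\<^bsub>obj C i\<^esub> \<in> cycles C i"
      using left_module.submoduleD(2)[OF complex_left_module[OF C] cycles_submodule[OF C]] .
    \<comment> \<open>Injectivity is a statement about pairs of classes, so the class of
      \<open>x\<close> is compared with that of zero.\<close>
    moreover have "homology_map D f i (boundaries C i +>\<^bsub>obj C i\<^esub> x)
        = homology_map D f i (boundaries C i +>\<^bsub>obj C i\<^esub> \<zero>\<^bsub>obj C i\<^esub>)"
      using fx fxc by (simp add: hm xc f0 BD.a_rcos_eq_self_iff BD.a_subset)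
    ultimately have "boundaries C i +>\<^bsub>obj C i\<^esub> x = boundaries C i +>\<^bsub>obj C i\<^esub> \<zero>\<^bsub>obj C i\<^esub>"
      using bij[of i] x unfolding bij_betw_def inj_on_def homology_carrier by blast
    then show ?thesis using xc by (simp add: BC.a_rcos_eq_self_iff BC.a_subset)
  qed
  moreover have "\<exists>x \<in> cycles C i. \<exists>w \<in> carrier (obj D (i + 1)).
        y = f i x \<oplus>\<^bsub>obj D i\<^esub> diff D (i + 1) w" if y: "y \<in> cycles D i" for i y
  proof -
    interpret BD: abelian_subgroup "boundaries D i" "obj D i" by (rule BD)
    have "boundaries D i +>\<^bsub>obj D i\<^esub> y \<in> homology_map D f i ` carrier (homology C i)"
      using bij[of i] y unfolding bij_betw_def by (auto simp: homology_carrier)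
    then obtain x where x: "x \<in> cycles C i" "boundaries D i +>\<^bsub>obj D i\<^esub> y = boundaries D i +>\<^bsub>obj D i\<^esub> f i x"
      using hm by (auto simp: homology_carrier cycles_iff)
    have "y \<in> boundaries D i +>\<^bsub>obj D i\<^esub> f i x"
      using BD.a_rcos_self[of y] y x(2) by (simp add: cycles_iff)
    then obtain w where w: "w \<in> carrier (obj D (i + 1))" "y = diff D (i + 1) w \<oplus>\<^bsub>obj D i\<^esub> f i x"
      by (auto simp: a_r_coset_def' boundaries_iff)
    moreover have "f i x \<in> carrier (obj D i)"
      using x(1) lin_hom_closed[OF chain_map_lin[OF f]] by (auto simp: cycles_iff)
    ultimately have "y = f i x \<oplus>\<^bsub>obj D i\<^esub> diff D (i + 1) w"
      using lin_hom_closed[OF complex_diff_lin_Suc[OF D] w(1)] by (simp add: BD.a_comm)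
    then show ?thesis using x w by blast
  qed
  ultimately show ?thesis using C D f by (auto simp: weak_equiv_def)
qed

lemma weak_equiv_id: "is_complex R C \<Longrightarrow> weak_equiv R C C (\<lambda>i x. x)"
proof -
  assume C: "is_complex R C"
  have "y = y \<oplus>\<^bsub>obj C i\<^esub> diff C (i + 1) \<zero>\<^bsub>obj C (i + 1)\<^esub>" "\<zero>\<^bsub>obj C (i + 1)\<^esub> \<in> carrier (obj C (i + 1))"
    if y: "y \<in> cycles C i" for i y
  proof -
    interpret M: left_module R "obj C i" using C by (rule complex_left_module)
    interpret N: left_module R "obj C (i + 1)" using C by (rule complex_left_module)
    show "y = y \<oplus>\<^bsub>obj C i\<^esub> diff C (i + 1) \<zero>\<^bsub>obj C (i + 1)\<^esub>" "\<zero>\<^bsub>obj C (i + 1)\<^esub> \<in> carrier (obj C (i + 1))"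
      using y lin_hom_zero[OF N.left_module_axioms M.left_module_axioms complex_diff_lin_Suc[OF C]]
      by (auto simp: cycles_iff)
  qed
  moreover have "chain_map R C C (\<lambda>i x. x)" by (simp add: chain_map_def lin_hom_id)
  ultimately show ?thesis using C unfolding weak_equiv_def by blast
qed

text \<open>For surjectivity the two boundary corrections combine: since \<open>g\<close> is a chain
  map, it carries the boundary of \<open>v\<close> to the boundary of its own value at
  \<open>v\<close>.\<close>

lemma weak_equiv_comp:
  assumes f: "weak_equiv R C D f" and g: "weak_equiv R D E g"
  shows "weak_equiv R C E (\<lambda>i x. g i (f i x))"
proof -
  note F = weak_equivD[OF f] and G = weak_equivD[OF g]
  have "\<exists>x \<in> cycles C i. \<exists>w \<in> carrier (obj E (i + 1)).
        y = g i (f i x) \<oplus>\<^bsub>obj E i\<^esub> diff E (i + 1) w" if y: "y \<in> cycles E i" for i y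
  proof -
    interpret E: left_module R "obj E i" using G(2) by (rule complex_left_module)
    interpret E1: left_module R "obj E (i + 1)" using G(2) by (rule complex_left_module)
    obtain z w where z: "z \<in> cycles D i" "w \<in> carrier (obj E (i + 1))"
      "y = g i z \<oplus>\<^bsub>obj E i\<^esub> diff E (i + 1) w" using G(5)[OF y] by blast
    obtain x v where x: "x \<in> cycles C i" "v \<in> carrier (obj D (i + 1))"
      "z = f i x \<oplus>\<^bsub>obj D i\<^esub> diff D (i + 1) v" using F(5)[OF z(1)] by blast
    have fx: "f i x \<in> carrier (obj D i)" using x(1) lin_hom_closed[OF chain_map_lin[OF F(3)]] by (simp add: cycles_iff)
    note d = lin_hom_closed[OF complex_diff_lin_Suc[OF F(2)] x(2)]
      and dE = complex_diff_lin_Suc[OF G(2), of i]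
    have gv: "g (i + 1) v \<in> carrier (obj E (i + 1))" using lin_hom_closed[OF chain_map_lin[OF G(3)] x(2)] .
    have gfx: "g i (f i x) \<in> carrier (obj E i)" using lin_hom_closed[OF chain_map_lin[OF G(3)] fx] .
    have "y = g i (f i x) \<oplus>\<^bsub>obj E i\<^esub> diff E (i + 1) (g (i + 1) v \<oplus>\<^bsub>obj E (i + 1)\<^esub> w)"
      using z(2) gv gfx lin_hom_closed[OF dE]
      by (simp add: z(3) x(3) lin_hom_add[OF chain_map_lin[OF G(3)] fx d] chain_map_diff_Suc[OF G(3) x(2)]
          lin_hom_add[OF dE] E.M.a_assoc)
    then show ?thesis using x(1) gv z(2) by blast
  qed
  moreover have "x \<in> boundaries C i" if "x \<in> cycles C i" "g i (f i x) \<in> boundaries E i" for i x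
    using that F(4) G(4) chain_map_cycles[OF F(1,2,3)] by blast
  ultimately show ?thesis using F(1) G(2) chain_map_comp[OF F(3) G(3)] unfolding weak_equiv_def by blast
qed

section \<open>Comparison theorem for bounded below complexes of projectives\<close>

section \<open>Lifting through quasi-isomorphisms\<close>

text \<open>Pairs \<open>(v, k)\<close> of a degree \<open>i\<close> lift and a degree \<open>i\<close> homotopy are built by recursion on the
  degree; all the recursion has to remember is their behaviour on cycles.\<close>

definition lift_on_cycles where
  "lift_on_cycles R A X Y q u i vk \<longleftrightarrow>
     fst vk \<in> lin_hom R (obj A i) (obj X i) \<and> snd vk \<in> lin_hom R (obj A i) (obj Y (i + 1)) \<and>
     (\<forall>c \<in> cycles A i. fst vk c \<in> cycles X i \<and>
        u i c = q i (fst vk c) \<oplus>\<^bsub>obj Y i\<^esub> diff Y (i + 1) (snd vk c))"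

text \<open>The two equations say that the lift commutes with the differential out of degree
  \<open>i + 1\<close>, and that \<open>u - q v = d k + k d\<close> holds in that degree, where
  \<open>v\<close> and \<open>k\<close> are the lift and the homotopy.\<close>

definition lift_step where
  "lift_step A X Y q u i vk vk' \<longleftrightarrow>
     (\<forall>a \<in> carrier (obj A (i + 1)).
        diff X (i + 1) (fst vk' a) = fst vk (diff A (i + 1) a) \<and>
        u (i + 1) a = q (i + 1) (fst vk' a) \<oplus>\<^bsub>obj Y (i + 1)\<^esub> diff Y (i + 1 + 1) (snd vk' a)
          \<oplus>\<^bsub>obj Y (i + 1)\<^esub> snd vk (diff A (i + 1) a))"

text \<open>Injectivity of \<open>q\<close> on homology gives a first lift \<open>x0\<close>
  compatible with the differentials. Surjectivity then corrects it by a cycle \<open>v1\<close> and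
  a homotopy \<open>k1\<close>. Projectivity makes both choices linear.\<close>

lemma lift_step_exists:
  assumes A: "is_complex R A" and pr: "projective R (obj A (i + 1))"
    and q: "weak_equiv R X Y q" and u: "chain_map R A Y u"
    and vk: "lift_on_cycles R A X Y q u i vk"
  shows "\<exists>vk'. lift_on_cycles R A X Y q u (i + 1) vk' \<and> lift_step A X Y q u i vk vk'"
proof -
  note Q = weak_equivD[OF q]
  obtain v k where vk_eq: "vk = (v, k)" by (cases vk)
  have v: "v \<in> lin_hom R (obj A i) (obj X i)" and k: "k \<in> lin_hom R (obj A i) (obj Y (i + 1))"
    and vc: "\<And>c. c \<in> cycles A i \<Longrightarrow> v c \<in> cycles X i"
    and uc: "\<And>c. c \<in> cycles A i \<Longrightarrow> u i c = q i (v c) \<oplus>\<^bsub>obj Y i\<^esub> diff Y (i + 1) (k c)"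
    using vk by (auto simp: lift_on_cycles_def vk_eq)
  note mA = complex_left_module[OF A] and mX = complex_left_module[OF Q(1)] and mY = complex_left_module[OF Q(2)]
  interpret A0: left_module R "obj A i" by (rule mA)
  interpret A1: left_module R "obj A (i + 1)" by (rule mA)
  interpret X1: left_module R "obj X (i + 1)" by (rule mX)
  interpret Y0: left_module R "obj Y i" by (rule mY)
  interpret Y1: left_module R "obj Y (i + 1)" by (rule mY)
  note dA = complex_diff_lin_Suc[OF A, of i] and dX = complex_diff_lin_Suc[OF Q(1), of i]
    and dY = complex_diff_lin_Suc[OF Q(2), of i] and dY2 = complex_diff_lin_Suc[OF Q(2), of "i + 1"]
    and q0 = chain_map_lin[OF Q(3), of i] and q1 = chain_map_lin[OF Q(3), of "i + 1"]
    and u1 = chain_map_lin[OF u, of "i + 1"]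
  have dc: "diff A (i + 1) a \<in> cycles A i" if "a \<in> carrier (obj A (i + 1))" for a
    by (rule subsetD[OF boundaries_subset_cycles[OF A, of i]]) (use that in \<open>auto simp: boundaries_iff\<close>)
  \<comment> \<open>Removing the known term of the homotopy leaves \<open>?w\<close>, whose
    differential turns out to be \<open>q\<close> applied to the prescribed differential of the
    lift. The latter is therefore a cycle that \<open>q\<close> sends to a boundary.\<close>
  let ?w = "\<lambda>a. u (i + 1) a \<ominus>\<^bsub>obj Y (i + 1)\<^esub> k (diff A (i + 1) a)"
  note w = Y1.lin_hom_diff[OF u1 lin_hom_comp[OF dA k]]
  have qv: "q i (v (diff A (i + 1) a)) = diff Y (i + 1) (?w a)" if a: "a \<in> carrier (obj A (i + 1))" for a
  proof -
    note c = dc[OF a]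
    have qc: "q i (v (diff A (i + 1) a)) \<in> carrier (obj Y i)"
      using lin_hom_closed[OF q0] vc[OF c] by (simp add: cycles_iff)
    have kc: "k (diff A (i + 1) a) \<in> carrier (obj Y (i + 1))"
      using lin_hom_closed[OF k] c by (simp add: cycles_iff)
    have "diff Y (i + 1) (?w a) = u i (diff A (i + 1) a) \<ominus>\<^bsub>obj Y i\<^esub> diff Y (i + 1) (k (diff A (i + 1) a))"
      by (simp only: lin_hom_minus[OF mY mY dY lin_hom_closed[OF u1 a] kc] chain_map_diff_Suc[OF u a])
    also have "\<dots> = q i (v (diff A (i + 1) a))"
      using qc lin_hom_closed[OF dY kc] by (simp add: uc[OF c] a_minus_def Y0.M.a_assoc Y0.M.r_neg)
    finally show ?thesis by simp
  qed
  have "\<exists>x\<in>carrier (obj X (i + 1)). v (diff A (i + 1) a) = diff X (i + 1) x"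
    if a: "a \<in> carrier (obj A (i + 1))" for a
    using Q(4)[OF vc[OF dc[OF a]]] qv[OF a] lin_hom_closed[OF w a] by (auto simp: boundaries_iff)
  then obtain x0 where x0: "x0 \<in> lin_hom R (obj A (i + 1)) (obj X (i + 1))"
    and dx0: "\<And>a. a \<in> carrier (obj A (i + 1)) \<Longrightarrow> v (diff A (i + 1) a) = diff X (i + 1) (x0 a)"
    using projective_lift[OF pr mX mX dX lin_hom_comp[OF dA v]] by blast
  \<comment> \<open>The defect of \<open>x0\<close> is a cycle of \<open>Y\<close>, so it can be
    absorbed through surjectivity on homology.\<close>
  let ?t = "\<lambda>a. ?w a \<ominus>\<^bsub>obj Y (i + 1)\<^esub> q (i + 1) (x0 a)"
  note t = Y1.lin_hom_diff[OF w lin_hom_comp[OF x0 q1]]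
  have tc: "?t a \<in> cycles Y (i + 1)" if a: "a \<in> carrier (obj A (i + 1))" for a
  proof -
    note xa = lin_hom_closed[OF x0 a]
    have "diff Y (i + 1) (?t a) = diff Y (i + 1) (?w a) \<ominus>\<^bsub>obj Y i\<^esub> diff Y (i + 1) (q (i + 1) (x0 a))"
      by (rule lin_hom_minus[OF mY mY dY lin_hom_closed[OF w a] lin_hom_closed[OF q1 xa]])
    also have "diff Y (i + 1) (q (i + 1) (x0 a)) = diff Y (i + 1) (?w a)"
      using qv[OF a] chain_map_diff_Suc[OF Q(3) xa] dx0[OF a] by simp
    also have "diff Y (i + 1) (?w a) \<ominus>\<^bsub>obj Y i\<^esub> diff Y (i + 1) (?w a) = \<zero>\<^bsub>obj Y i\<^esub>"
      using lin_hom_closed[OF dY lin_hom_closed[OF w a]] by (simp only: a_minus_def[of "obj Y i"] Y0.M.r_neg)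
    finally show ?thesis using lin_hom_closed[OF t a] by (simp add: cycles_iff)
  qed
  note cyc = cycles_submodule[OF Q(1), of "i + 1"]
  note cycs = X1.submoduleD(1)[OF cyc]
  \<comment> \<open>The codomain is restricted to the cycles, so that adding \<open>v1\<close> to
    \<open>x0\<close> leaves the differential of the lift unchanged.\<close>
  obtain v1 k1 where v1: "v1 \<in> lin_hom R (obj A (i + 1)) (obj X (i + 1)\<lparr>carrier := cycles X (i + 1)\<rparr>)"
    and k1: "k1 \<in> lin_hom R (obj A (i + 1)) (obj Y (i + 1 + 1))"
    and vk1: "\<And>a. a \<in> carrier (obj A (i + 1)) \<Longrightarrow>
      ?t a = q (i + 1) (v1 a) \<oplus>\<^bsub>obj Y (i + 1)\<^esub> diff Y (i + 1 + 1) (k1 a)"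
  proof (rule projective_lift2[OF pr X1.submodule_is_left_module[OF cyc] mY mY lin_hom_restrict[OF q1 cycs] dY2 t])
    show "\<exists>a1\<in>carrier (obj X (i + 1)\<lparr>carrier := cycles X (i + 1)\<rparr>). \<exists>a2\<in>carrier (obj Y (i + 1 + 1)).
      ?t a = q (i + 1) a1 \<oplus>\<^bsub>obj Y (i + 1)\<^esub> diff Y (i + 1 + 1) a2" if "a \<in> carrier (obj A (i + 1))" for a
      using Q(5)[OF tc[OF that]] by simp
  qed blast
  have v1X: "v1 \<in> lin_hom R (obj A (i + 1)) (obj X (i + 1))" using lin_hom_expand[OF v1 cycs] .
  define v' where "v' = (\<lambda>a. x0 a \<oplus>\<^bsub>obj X (i + 1)\<^esub> v1 a)"
  have v': "v' \<in> lin_hom R (obj A (i + 1)) (obj X (i + 1))"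
    unfolding v'_def by (rule X1.lin_hom_plus[OF x0 v1X])
  have dv': "diff X (i + 1) (v' a) = v (diff A (i + 1) a)" if a: "a \<in> carrier (obj A (i + 1))" for a
  proof -
    interpret X0: left_module R "obj X i" by (rule mX)
    have "diff X (i + 1) (v1 a) = \<zero>\<^bsub>obj X i\<^esub>" using lin_hom_closed[OF v1 a] by (simp add: cycles_iff)
    then show ?thesis
      using lin_hom_closed[OF dX lin_hom_closed[OF x0 a]]
      by (simp add: v'_def lin_hom_add[OF dX lin_hom_closed[OF x0 a] lin_hom_closed[OF v1X a]] dx0[OF a])
  qed
  have uv': "u (i + 1) a = q (i + 1) (v' a) \<oplus>\<^bsub>obj Y (i + 1)\<^esub> diff Y (i + 1 + 1) (k1 a)
          \<oplus>\<^bsub>obj Y (i + 1)\<^esub> k (diff A (i + 1) a)" if a: "a \<in> carrier (obj A (i + 1))" for a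
  proof -
    note c = lin_hom_closed[OF u1 a] lin_hom_closed[OF lin_hom_comp[OF dA k] a]
      lin_hom_closed[OF lin_hom_comp[OF x0 q1] a] lin_hom_closed[OF lin_hom_comp[OF v1X q1] a]
      lin_hom_closed[OF lin_hom_comp[OF k1 dY2] a]
    have "q (i + 1) (v' a) \<oplus>\<^bsub>obj Y (i + 1)\<^esub> diff Y (i + 1 + 1) (k1 a) = q (i + 1) (x0 a) \<oplus>\<^bsub>obj Y (i + 1)\<^esub> ?t a"
      unfolding v'_def vk1[OF a] lin_hom_add[OF q1 lin_hom_closed[OF x0 a] lin_hom_closed[OF v1X a]]
      using c by (simp only: Y1.M.a_assoc)
    also have "\<dots> = ?w a"
      using c lin_hom_closed[OF w a] by (simp add: a_minus_def[of "obj Y (i + 1)" _ "q (i + 1) (x0 a)"]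
         Y1.M.a_comm Y1.M.a_lcomm Y1.M.r_neg2)
    also have "?w a \<oplus>\<^bsub>obj Y (i + 1)\<^esub> k (diff A (i + 1) a) = u (i + 1) a"
      using c by (simp add: a_minus_def Y1.M.a_assoc Y1.M.l_neg)
    finally show ?thesis by simp
  qed
  \<comment> \<open>On a cycle the terms involving \<open>diff A\<close> vanish, so the invariant
    for the next degree follows from the step equations.\<close>
  have "lift_on_cycles R A X Y q u (i + 1) (v', k1)"
    unfolding lift_on_cycles_def fst_conv snd_conv
  proof (intro conjI ballI)
    fix c assume c: "c \<in> cycles A (i + 1)"
    then have cA: "c \<in> carrier (obj A (i + 1))" and dc0: "diff A (i + 1) c = \<zero>\<^bsub>obj A i\<^esub>" by (auto simp: cycles_iff)
    have "v \<zero>\<^bsub>obj A i\<^esub> = \<zero>\<^bsub>obj X i\<^esub>" "k \<zero>\<^bsub>obj A i\<^esub> = \<zero>\<^bsub>obj Y (i + 1)\<^esub>"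
      using lin_hom_zero[OF mA mX v] lin_hom_zero[OF mA mY k] by auto
    then show "v' c \<in> cycles X (i + 1)"
      "u (i + 1) c = q (i + 1) (v' c) \<oplus>\<^bsub>obj Y (i + 1)\<^esub> diff Y (i + 1 + 1) (k1 c)"
      using dv'[OF cA] uv'[OF cA] lin_hom_closed[OF v' cA] lin_hom_closed[OF lin_hom_comp[OF v' q1] cA]
        lin_hom_closed[OF lin_hom_comp[OF k1 dY2] cA]
      by (simp_all add: cycles_iff dc0 del: add.assoc)
  qed (rule v' k1)+
  moreover have "lift_step A X Y q u i vk (v', k1)"
    using dv' uv' by (simp add: lift_step_def vk_eq)
  ultimately show ?thesis by blast
qed

text \<open>Below some degree \<open>A\<close> vanishes and zero maps serve; from there
  \<open>lift_step_exists\<close> is iterated upwards. As \<open>i\<close> ranges over all integers,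
  the equation in degree \<open>i + 1\<close> covers every degree.\<close>

lemma chain_map_lift:
  assumes A: "is_complex R A" and pr: "\<And>i. projective R (obj A i)"
    and q: "weak_equiv R X Y q" and u: "chain_map R A Y u"
  obtains v k where "chain_map R A X v"
    "\<And>i. k i \<in> lin_hom R (obj A i) (obj Y (i + 1))"
    "\<And>i a. a \<in> carrier (obj A (i + 1)) \<Longrightarrow>
       u (i + 1) a = q (i + 1) (v (i + 1) a) \<oplus>\<^bsub>obj Y (i + 1)\<^esub> diff Y (i + 1 + 1) (k (i + 1) a)
          \<oplus>\<^bsub>obj Y (i + 1)\<^esub> k i (diff A (i + 1) a)"
proof -
  note Q = weak_equivD[OF q]
  note mA = complex_left_module[OF A] and mX = complex_left_module[OF Q(1)] and mY = complex_left_module[OF Q(2)]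
  let ?z = "\<lambda>i. (\<lambda>x. \<zero>\<^bsub>obj X i\<^esub>, \<lambda>x. \<zero>\<^bsub>obj Y (i + 1)\<^esub>)"
  obtain N where N: "\<And>i. i < N \<Longrightarrow> zero_module (obj A i)" using A by (auto simp: is_complex_def)
  have uz: "u i a = \<zero>\<^bsub>obj Y i\<^esub>" if "a \<in> carrier (obj A i)" "i < N" for i a
    using N[OF that(2)] that(1) lin_hom_zero[OF mA mY chain_map_lin[OF u, of i]] by (simp add: zero_module_def)
  have qz: "q i \<zero>\<^bsub>obj X i\<^esub> = \<zero>\<^bsub>obj Y i\<^esub>" for i by (rule lin_hom_zero[OF mX mY chain_map_lin[OF Q(3)]])
  have dXz: "diff X (i + 1) \<zero>\<^bsub>obj X (i + 1)\<^esub> = \<zero>\<^bsub>obj X i\<^esub>" for i by (rule lin_hom_zero[OF mX mX complex_diff_lin_Suc[OF Q(1)]])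
  have dXz': "diff X i \<zero>\<^bsub>obj X i\<^esub> = \<zero>\<^bsub>obj X (i - 1)\<^esub>" for i by (rule lin_hom_zero[OF mX mX complex_diff_lin[OF Q(1)]])
  have dYz: "diff Y (i + 1) \<zero>\<^bsub>obj Y (i + 1)\<^esub> = \<zero>\<^bsub>obj Y i\<^esub>" for i by (rule lin_hom_zero[OF mY mY complex_diff_lin_Suc[OF Q(2)]])
  have zX: "\<zero>\<^bsub>obj X i\<^esub> \<in> carrier (obj X i)" for i
    by (rule abelian_groupE(2)[OF left_module_abelian_group[OF mX]])
  have zY: "\<zero>\<^bsub>obj Y i\<^esub> \<oplus>\<^bsub>obj Y i\<^esub> \<zero>\<^bsub>obj Y i\<^esub> = \<zero>\<^bsub>obj Y i\<^esub>" for i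
    using left_module_abelian_group[OF mY[of i]] by (simp add: abelian_groupE(2,5))
  have base: "lift_on_cycles R A X Y q u i (?z i)" if "i < N" for i
    using left_module.lin_hom_zero_map[OF mX] left_module.lin_hom_zero_map[OF mY] that
    by (auto simp: lift_on_cycles_def cycles_iff zX dXz' qz dYz zY uz)
  have bstep: "lift_step A X Y q u i (?z i) (?z (i + 1))" if "i + 1 < N" for i
    unfolding lift_step_def fst_conv snd_conv by (simp only: dXz qz dYz zY) (use uz that in simp)
  \<comment> \<open>The recursion starts in the last degree where \<open>A\<close> is known to
    vanish, so its initial pair is zero and joins the zero pairs below.\<close>
  define N0 where "N0 = N - 1"
  have "\<exists>s. \<forall>n. lift_on_cycles R A X Y q u (N0 + int n) (s n) \<and> lift_step A X Y q u (N0 + int n) (s n) (s (Suc n)) \<and>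
     (n = 0 \<longrightarrow> s n = ?z N0)"
  proof -
    have "\<exists>s. \<forall>n. (lift_on_cycles R A X Y q u (N0 + int n) (s n) \<and> (n = 0 \<longrightarrow> s n = ?z N0)) \<and>
       lift_step A X Y q u (N0 + int n) (s n) (s (Suc n))"
    \<comment> \<open>Each pair depends on the preceding one, hence dependent choice. The clause for
      \<open>n = 0\<close> carries the initial value through it.\<close>
    proof (rule dependent_nat_choice)
      show "\<exists>vk. lift_on_cycles R A X Y q u (N0 + int 0) vk \<and> (0 = (0::nat) \<longrightarrow> vk = ?z N0)"
        using base[of N0] by (simp add: N0_def)
    next
      fix vk n assume "lift_on_cycles R A X Y q u (N0 + int n) vk \<and> (n = 0 \<longrightarrow> vk = ?z N0)"
      then have "lift_on_cycles R A X Y q u (N0 + int n) vk" by blast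
      from lift_step_exists[OF A pr q u this]
      show "\<exists>vk'. (lift_on_cycles R A X Y q u (N0 + int (Suc n)) vk' \<and> (Suc n = 0 \<longrightarrow> vk' = ?z N0)) \<and>
         lift_step A X Y q u (N0 + int n) vk vk'"
        by (simp add: ac_simps)
    qed
    then show ?thesis by blast
  qed
  then obtain s where s: "\<And>n. lift_on_cycles R A X Y q u (N0 + int n) (s n)"
    "\<And>n. lift_step A X Y q u (N0 + int n) (s n) (s (Suc n))" "s 0 = ?z N0" by blast
  define vk where "vk i = (if i < N0 then ?z i else s (nat (i - N0)))" for i
  have good: "lift_on_cycles R A X Y q u i (vk i)" for i
    using s(1)[of "nat (i - N0)"] base[of i] by (auto simp: vk_def N0_def split: if_splits)
  have step: "lift_step A X Y q u i (vk i) (vk (i + 1))" for i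
  proof (cases "i < N0")
    case True
    then consider "i + 1 < N0" | "N0 = i + 1" by linarith
    then have "vk (i + 1) = ?z (i + 1)" by cases (simp_all add: vk_def s(3))
    then show ?thesis using bstep[of i] True by (simp add: vk_def N0_def)
  next
    case False
    then have "nat (i + 1 - N0) = Suc (nat (i - N0))" by simp
    then show ?thesis using s(2)[of "nat (i - N0)"] False by (simp add: vk_def)
  qed
  show ?thesis
  proof (rule that[of "\<lambda>i. fst (vk i)" "\<lambda>i. snd (vk i)"])
    show "chain_map R A X (\<lambda>i. fst (vk i))"
    proof -
      have "fst (vk (i - 1)) (diff A i x) = diff X i (fst (vk i) x)" if "x \<in> carrier (obj A i)" for i x
        using step[of "i - 1"] that by (simp add: lift_step_def)
      then show ?thesis using good by (auto simp: chain_map_def lift_on_cycles_def)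
    qed
    show "snd (vk i) \<in> lin_hom R (obj A i) (obj Y (i + 1))" for i using good[of i] by (simp add: lift_on_cycles_def)
  qed (use step in \<open>auto simp: lift_step_def\<close>)
qed

text \<open>Lifting \<open>u\<close> through \<open>q\<close> gives a chain map \<open>v\<close>
  with \<open>q v\<close> homotopic to \<open>u\<close>. As \<open>q\<close> and \<open>u\<close>
  are isomorphisms on homology, so is \<open>v\<close>, by two out of three.\<close>

lemma weak_equiv_lift:
  assumes pr: "\<And>i. projective R (obj A i)"
    and q: "weak_equiv R X Y q" and u: "weak_equiv R A Y u"
  shows "\<exists>v. weak_equiv R A X v"
proof -
  note Q = weak_equivD[OF q] and U = weak_equivD[OF u]
  obtain v k where v: "chain_map R A X v" and k: "\<And>i. k i \<in> lin_hom R (obj A i) (obj Y (i + 1))"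
    and vk: "\<And>i a. a \<in> carrier (obj A (i + 1)) \<Longrightarrow>
       u (i + 1) a = q (i + 1) (v (i + 1) a) \<oplus>\<^bsub>obj Y (i + 1)\<^esub> diff Y (i + 1 + 1) (k (i + 1) a)
          \<oplus>\<^bsub>obj Y (i + 1)\<^esub> k i (diff A (i + 1) a)"
    using chain_map_lift[OF U(1) pr q U(3)] by blast
  note mA = complex_left_module[OF U(1)] and mX = complex_left_module[OF Q(1)] and mY = complex_left_module[OF Q(2)]
  have cyc: "u i a = q i (v i a) \<oplus>\<^bsub>obj Y i\<^esub> diff Y (i + 1) (k i a)"
    and vc: "v i a \<in> carrier (obj X i)" and qvc: "q i (v i a) \<in> carrier (obj Y i)"
    and kc: "k i a \<in> carrier (obj Y (i + 1))" and dkc: "diff Y (i + 1) (k i a) \<in> carrier (obj Y i)"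
    if a: "a \<in> cycles A i" for i a
  proof -
    have aA: "a \<in> carrier (obj A i)" using a by (simp add: cycles_iff)
    interpret Y: left_module R "obj Y i" by (rule mY)
    show c: "v i a \<in> carrier (obj X i)" "q i (v i a) \<in> carrier (obj Y i)"
      "k i a \<in> carrier (obj Y (i + 1))" "diff Y (i + 1) (k i a) \<in> carrier (obj Y i)"
      using lin_hom_closed[OF lin_hom_comp[OF chain_map_lin[OF v] chain_map_lin[OF Q(3)]] aA]
        lin_hom_closed[OF chain_map_lin[OF v] aA]
        lin_hom_closed[OF k aA] lin_hom_closed[OF lin_hom_comp[OF k complex_diff_lin_Suc[OF Q(2)]] aA] by auto
    \<comment> \<open>The homotopy equation is used at index \<open>i - 1\<close> to reach degree
      \<open>i\<close>; on a cycle its last term is \<open>k\<close> applied to zero.\<close>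
    have "k (i - 1) \<zero>\<^bsub>obj A (i - 1)\<^esub> = \<zero>\<^bsub>obj Y i\<^esub>"
      using lin_hom_zero[OF mA mY k[of "i - 1"]] by simp
    then show "u i a = q i (v i a) \<oplus>\<^bsub>obj Y i\<^esub> diff Y (i + 1) (k i a)"
      using vk[of a "i - 1"] a c by (simp add: cycles_iff)
  qed
  have "a \<in> boundaries A i" if a: "a \<in> cycles A i" and b: "v i a \<in> boundaries X i" for i a
  proof -
    interpret Y1: left_module R "obj Y (i + 1)" by (rule mY)
    obtain z where z: "z \<in> carrier (obj X (i + 1))" "v i a = diff X (i + 1) z" using b by (auto simp: boundaries_iff)
    have "u i a = diff Y (i + 1) (q (i + 1) z \<oplus>\<^bsub>obj Y (i + 1)\<^esub> k i a)"
      using lin_hom_add[OF complex_diff_lin_Suc[OF Q(2)] lin_hom_closed[OF chain_map_lin[OF Q(3)] z(1)] kc[OF a]]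
      by (simp add: cyc[OF a] z(2) chain_map_diff_Suc[OF Q(3) z(1)])
    then have "u i a \<in> boundaries Y i"
      using lin_hom_closed[OF chain_map_lin[OF Q(3)] z(1)] kc[OF a] by (auto simp: boundaries_iff)
    then show ?thesis using U(4)[OF a] by simp
  qed
  moreover have "\<exists>x \<in> cycles A i. \<exists>w \<in> carrier (obj X (i + 1)). y = v i x \<oplus>\<^bsub>obj X i\<^esub> diff X (i + 1) w"
    if y: "y \<in> cycles X i" for i y
  proof -
    interpret Y: left_module R "obj Y i" by (rule mY)
    interpret Y1: left_module R "obj Y (i + 1)" by (rule mY)
    interpret X: left_module R "obj X i" by (rule mX)
    obtain x w where x: "x \<in> cycles A i" "w \<in> carrier (obj Y (i + 1))" "q i y = u i x \<oplus>\<^bsub>obj Y i\<^esub> diff Y (i + 1) w"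
      using U(5)[OF chain_map_cycles[OF Q(1,2,3) y]] by blast
    note q0 = chain_map_lin[OF Q(3), of i] and dY = complex_diff_lin_Suc[OF Q(2), of i]
    have yX: "y \<in> carrier (obj X i)" using y by (simp add: cycles_iff)
    \<comment> \<open>The difference is a cycle, and \<open>q\<close> sends it to a boundary;
      injectivity of \<open>q\<close> on homology makes it a boundary in \<open>X\<close>.\<close>
    have dif: "y \<ominus>\<^bsub>obj X i\<^esub> v i x \<in> cycles X i"
      using X.submoduleD[OF cycles_submodule[OF Q(1), of i]] y chain_map_cycles[OF U(1) Q(1) v x(1)]
      by (simp add: a_minus_def)
    have "q i (y \<ominus>\<^bsub>obj X i\<^esub> v i x) = q i y \<ominus>\<^bsub>obj Y i\<^esub> q i (v i x)"
      by (rule lin_hom_minus[OF mX mY q0 yX vc[OF x(1)]])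
    also have "\<dots> = diff Y (i + 1) (k i x) \<oplus>\<^bsub>obj Y i\<^esub> diff Y (i + 1) w"
    proof -
      have "p \<oplus>\<^bsub>obj Y i\<^esub> r \<oplus>\<^bsub>obj Y i\<^esub> t \<ominus>\<^bsub>obj Y i\<^esub> p = r \<oplus>\<^bsub>obj Y i\<^esub> t"
        if "p \<in> carrier (obj Y i)" "r \<in> carrier (obj Y i)" "t \<in> carrier (obj Y i)" for p r t
      proof -
        have "p \<oplus>\<^bsub>obj Y i\<^esub> r \<oplus>\<^bsub>obj Y i\<^esub> t \<ominus>\<^bsub>obj Y i\<^esub> p = (p \<oplus>\<^bsub>obj Y i\<^esub> \<ominus>\<^bsub>obj Y i\<^esub> p) \<oplus>\<^bsub>obj Y i\<^esub> (r \<oplus>\<^bsub>obj Y i\<^esub> t)"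
          using that by (simp add: a_minus_def Y.M.a_ac)
        then show ?thesis using that by (simp add: Y.M.r_neg)
      qed
      then show ?thesis using qvc[OF x(1)] dkc[OF x(1)] lin_hom_closed[OF dY x(2)] by (simp add: x(3) cyc[OF x(1)])
    qed
    also have "\<dots> = diff Y (i + 1) (k i x \<oplus>\<^bsub>obj Y (i + 1)\<^esub> w)" by (rule lin_hom_add[OF dY kc[OF x(1)] x(2), symmetric])
    finally have "q i (y \<ominus>\<^bsub>obj X i\<^esub> v i x) \<in> boundaries Y i"
      using kc[OF x(1)] x(2) by (auto simp: boundaries_iff)
    then obtain z where z: "z \<in> carrier (obj X (i + 1))" "y \<ominus>\<^bsub>obj X i\<^esub> v i x = diff X (i + 1) z"
      using Q(4)[OF dif] by (auto simp: boundaries_iff)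
    have "y = v i x \<oplus>\<^bsub>obj X i\<^esub> (y \<ominus>\<^bsub>obj X i\<^esub> v i x)"
      using yX vc[OF x(1)] by (simp add: a_minus_def X.M.a_lcomm X.M.r_neg)
    then show ?thesis using x(1) z by auto
  qed
  ultimately have "weak_equiv R A X v" using U(1) Q(1) v unfolding weak_equiv_def by blast
  then show ?thesis by blast
qed

text \<open>A zigzag collapses to a single arrow out of a bounded below complex of projectives.
  Walking along it from \<open>S\<close>, a forward arrow is composed and a backward arrow is lifted
  through.\<close>

lemma quasi_isomorphic_weak_equiv:
  assumes S: "is_complex R S" and pr: "\<And>i. projective R (obj S i)"
    and FS: "quasi_isomorphic R F S"
  shows "\<exists>f. weak_equiv R S F f"
proof -
  let ?r = "\<lambda>Y Z. \<exists>f. quasi_iso R Y Z f"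
  obtain X where X: "(\<exists>f. quasi_iso R F X f) \<or> (\<exists>f. quasi_iso R X F f)" "equivclp ?r X S"
    using FS unfolding quasi_isomorphic_def by blast
  from X(2) have "equivclp ?r S X" by (rule equivclp_sym)
  then have "\<exists>f. weak_equiv R S X f"
  proof (induction rule: equivclp_induct)
    case base
    show ?case using weak_equiv_id[OF S] by blast
  next
    case (step Y Z)
    then show ?case using quasi_iso_weak_equiv weak_equiv_comp weak_equiv_lift[OF pr] by metis
  qed
  then show ?thesis using X(1) quasi_iso_weak_equiv weak_equiv_comp weak_equiv_lift[OF pr] by metis
qed

section \<open>Retractions onto direct summands of complexes\<close>

section \<open>Direct summands\<close>

lemma sub_cplx_simps [simp]:
  "obj (sub_cplx C G) i = (obj C i)\<lparr>carrier := G i\<rparr>"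
  "diff (sub_cplx C G) i = diff C i"
  by (simp_all add: sub_cplx_def)

lemma subcomplexD:
  assumes "subcomplex R C G"
  shows "submodule (G i) R (obj C i)" "\<And>x. x \<in> G i \<Longrightarrow> diff C i x \<in> G (i - 1)"
  using assms by (auto simp: subcomplex_def)

lemma sub_cplx_complex:
  assumes C: "is_complex R C" and G: "subcomplex R C G"
  shows "is_complex R (sub_cplx C G)"
  unfolding is_complex_def
proof (intro conjI allI ballI)
  note sub = left_module.submoduleD[OF complex_left_module[OF C] subcomplexD(1)[OF G]]
  show "left_module R (obj (sub_cplx C G) i)" for i
    by (simp add: left_module.submodule_is_left_module[OF complex_left_module[OF C] subcomplexD(1)[OF G]])
  show "diff (sub_cplx C G) i \<in> lin_hom R (obj (sub_cplx C G) i) (obj (sub_cplx C G) (i - 1))" for i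
    unfolding sub_cplx_simps
    by (rule lin_hom_corestrict[OF lin_hom_restrict[OF complex_diff_lin[OF C] sub(1)]])
      (simp add: subcomplexD(2)[OF G])
  show "diff (sub_cplx C G) (i - 1) (diff (sub_cplx C G) i x) = \<zero>\<^bsub>obj (sub_cplx C G) (i - 1 - 1)\<^esub>"
    if "x \<in> carrier (obj (sub_cplx C G) i)" for i x
    using that C sub(1)[of i] by (auto simp: is_complex_def)
  obtain N where "\<forall>i<N. zero_module (obj C i)" using C by (auto simp: is_complex_def)
  then have "\<forall>i<N. zero_module (obj (sub_cplx C G) i)"
    using sub(1,2) by (auto simp: zero_module_def)
  then show "\<exists>N. \<forall>i<N. zero_module (obj (sub_cplx C G) i)" by blast
qed

text \<open>The retraction is the projection along the complement \<open>H\<close>. It commutes with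
  the differentials because both \<open>S\<close> and \<open>H\<close> are subcomplexes and
  decompositions are unique.\<close>

lemma direct_summand_retraction:
  assumes C: "is_complex R C" and S: "direct_summand R C S"
  obtains r where "chain_map R C (sub_cplx C S) r" "\<And>i x. x \<in> S i \<Longrightarrow> r i x = x"
proof -
  obtain H where SC: "subcomplex R C S" and HC: "subcomplex R C H"
    and int: "\<And>i. S i \<inter> H i = {\<zero>\<^bsub>obj C i\<^esub>}" and sum: "\<And>i. set_add (obj C i) (S i) (H i) = carrier (obj C i)"
    using S unfolding direct_summand_def by blast
  note m = complex_left_module[OF C]
  note Ssub = left_module.submoduleD[OF m subcomplexD(1)[OF SC]]
  note Hsub = left_module.submoduleD[OF m subcomplexD(1)[OF HC]]
  \<comment> \<open>The component in \<open>S\<close> is picked by choice; \<open>uniq\<close> then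
    shows that any decomposition computes it, from which linearity follows.\<close>
  define r where "r i x = (SOME g. g \<in> S i \<and> (\<exists>h\<in>H i. x = g \<oplus>\<^bsub>obj C i\<^esub> h))" for i x
  have dec: "r i x \<in> S i \<and> (\<exists>h\<in>H i. x = r i x \<oplus>\<^bsub>obj C i\<^esub> h)" if "x \<in> carrier (obj C i)" for i x
  proof -
    have "\<exists>g. g \<in> S i \<and> (\<exists>h\<in>H i. x = g \<oplus>\<^bsub>obj C i\<^esub> h)"
      using that sum[of i, symmetric] by (auto simp: set_add_def')
    then show ?thesis unfolding r_def by (rule someI_ex)
  qed
  have uniq: "r i (g \<oplus>\<^bsub>obj C i\<^esub> h) = g" if g: "g \<in> S i" and h: "h \<in> H i" for i g h
  proof -
    interpret M: left_module R "obj C i" by (rule m)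
    have c: "g \<in> carrier (obj C i)" "h \<in> carrier (obj C i)" using g h Ssub(1)[of i] Hsub(1)[of i] by auto
    obtain h' where h': "h' \<in> H i" "g \<oplus>\<^bsub>obj C i\<^esub> h = r i (g \<oplus>\<^bsub>obj C i\<^esub> h) \<oplus>\<^bsub>obj C i\<^esub> h'"
      and g': "r i (g \<oplus>\<^bsub>obj C i\<^esub> h) \<in> S i"
      using dec[of "g \<oplus>\<^bsub>obj C i\<^esub> h" i] c by auto
    define g' where "g' = r i (g \<oplus>\<^bsub>obj C i\<^esub> h)"
    have c': "h' \<in> carrier (obj C i)" "g' \<in> carrier (obj C i)" using h' g' Ssub(1)[of i] Hsub(1)[of i] by (auto simp: g'_def)
    have eq: "g \<oplus>\<^bsub>obj C i\<^esub> h = g' \<oplus>\<^bsub>obj C i\<^esub> h'" using h'(2) by (simp add: g'_def)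
    have "g \<ominus>\<^bsub>obj C i\<^esub> g' = (g \<oplus>\<^bsub>obj C i\<^esub> h) \<ominus>\<^bsub>obj C i\<^esub> (g' \<oplus>\<^bsub>obj C i\<^esub> h)"
    proof -
      have "(g \<oplus>\<^bsub>obj C i\<^esub> h) \<ominus>\<^bsub>obj C i\<^esub> (g' \<oplus>\<^bsub>obj C i\<^esub> h)
          = (g \<ominus>\<^bsub>obj C i\<^esub> g') \<oplus>\<^bsub>obj C i\<^esub> (h \<oplus>\<^bsub>obj C i\<^esub> \<ominus>\<^bsub>obj C i\<^esub> h)"
        using c c' by (simp add: a_minus_def M.M.minus_add M.M.a_ac)
      then show ?thesis using c c' by (simp add: M.M.r_neg)
    qed
    also have "\<dots> = h' \<ominus>\<^bsub>obj C i\<^esub> h"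
    proof -
      have "(g' \<oplus>\<^bsub>obj C i\<^esub> h') \<ominus>\<^bsub>obj C i\<^esub> (g' \<oplus>\<^bsub>obj C i\<^esub> h)
          = (h' \<ominus>\<^bsub>obj C i\<^esub> h) \<oplus>\<^bsub>obj C i\<^esub> (g' \<oplus>\<^bsub>obj C i\<^esub> \<ominus>\<^bsub>obj C i\<^esub> g')"
        using c c' by (simp add: a_minus_def M.M.minus_add M.M.a_ac)
      then show ?thesis using c c' by (simp add: M.M.r_neg eq)
    qed
    finally have gh: "g \<ominus>\<^bsub>obj C i\<^esub> g' = h' \<ominus>\<^bsub>obj C i\<^esub> h" .
    have "g \<ominus>\<^bsub>obj C i\<^esub> g' \<in> S i" using g g' Ssub by (simp add: a_minus_def g'_def)
    moreover have "h' \<ominus>\<^bsub>obj C i\<^esub> h \<in> H i" using h h' Hsub by (simp add: a_minus_def)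
    ultimately have "g \<ominus>\<^bsub>obj C i\<^esub> g' = \<zero>\<^bsub>obj C i\<^esub>" using gh int[of i] by auto
    then show ?thesis using c c' unfolding g'_def[symmetric] a_minus_def
      by (metis M.M.a_inv_closed M.M.add.inv_equality M.M.minus_minus)
  qed
  have rS: "r i x = x" if "x \<in> S i" for i x
  proof -
    interpret M: left_module R "obj C i" by (rule m)
    show ?thesis using uniq[OF that Hsub(2)] that Ssub(1)[of i] by auto
  qed
  have lin: "r i \<in> lin_hom R (obj C i) ((obj C i)\<lparr>carrier := S i\<rparr>)" for i
  proof (intro lin_homI; simp)
    interpret M: left_module R "obj C i" by (rule m)
    fix x assume x: "x \<in> carrier (obj C i)"
    then show "r i x \<in> S i" using dec by blast
    obtain h where h: "h \<in> H i" "x = r i x \<oplus>\<^bsub>obj C i\<^esub> h" and rx: "r i x \<in> S i" using dec[OF x] by blast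
    have c: "r i x \<in> carrier (obj C i)" "h \<in> carrier (obj C i)" using rx h Ssub(1)[of i] Hsub(1)[of i] by auto
    {
      fix s assume s: "s \<in> carrier R"
      have "r i (s \<odot>\<^bsub>obj C i\<^esub> r i x \<oplus>\<^bsub>obj C i\<^esub> s \<odot>\<^bsub>obj C i\<^esub> h) = s \<odot>\<^bsub>obj C i\<^esub> r i x"
        by (rule uniq) (use s rx h Ssub(5) Hsub(5) in auto)
      then show "r i (s \<odot>\<^bsub>obj C i\<^esub> x) = s \<odot>\<^bsub>obj C i\<^esub> r i x"
        using M.smult_r_distr[OF s c] h(2) by simp
    }
    fix y assume y: "y \<in> carrier (obj C i)"
    obtain k where k: "k \<in> H i" "y = r i y \<oplus>\<^bsub>obj C i\<^esub> k" and ry: "r i y \<in> S i" using dec[OF y] by blast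
    have d: "r i y \<in> carrier (obj C i)" "k \<in> carrier (obj C i)" using ry k Ssub(1)[of i] Hsub(1)[of i] by auto
    have "r i ((r i x \<oplus>\<^bsub>obj C i\<^esub> r i y) \<oplus>\<^bsub>obj C i\<^esub> (h \<oplus>\<^bsub>obj C i\<^esub> k)) = r i x \<oplus>\<^bsub>obj C i\<^esub> r i y"
      by (rule uniq) (use rx ry h k Ssub(4) Hsub(4) in auto)
    moreover have "(r i x \<oplus>\<^bsub>obj C i\<^esub> r i y) \<oplus>\<^bsub>obj C i\<^esub> (h \<oplus>\<^bsub>obj C i\<^esub> k)
        = (r i x \<oplus>\<^bsub>obj C i\<^esub> h) \<oplus>\<^bsub>obj C i\<^esub> (r i y \<oplus>\<^bsub>obj C i\<^esub> k)"
      using c d by (simp add: M.M.a_ac)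
    ultimately show "r i (x \<oplus>\<^bsub>obj C i\<^esub> y) = r i x \<oplus>\<^bsub>obj C i\<^esub> r i y"
      using h(2) k(2) by simp
  qed
  have comm: "r (i - 1) (diff C i x) = diff C i (r i x)" if x: "x \<in> carrier (obj C i)" for i x
  proof -
    obtain h where h: "h \<in> H i" "x = r i x \<oplus>\<^bsub>obj C i\<^esub> h" and rx: "r i x \<in> S i" using dec[OF x] by blast
    have c: "r i x \<in> carrier (obj C i)" "h \<in> carrier (obj C i)" using rx h Ssub(1)[of i] Hsub(1)[of i] by auto
    have "diff C i x = diff C i (r i x) \<oplus>\<^bsub>obj C (i - 1)\<^esub> diff C i h"
      using lin_hom_add[OF complex_diff_lin[OF C] c] h(2) by simp
    then show ?thesis using uniq[OF subcomplexD(2)[OF SC rx] subcomplexD(2)[OF HC h(1)]] by simp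
  qed
  show ?thesis
    by (rule that[of r]) (use lin comm rS in \<open>auto simp: chain_map_def\<close>)
qed

section \<open>Projective filtrations and the ghost argument along them\<close>

section \<open>Projective filtrations\<close>

lemma zero_module_projective:
  assumes M: "left_module R M" and z: "zero_module M"
  shows "projective R M"
proof -
  interpret M: left_module R M by fact
  interpret Fr: left_module R "free_module R (carrier M)" by (rule M.R.free_left_module)
  show ?thesis
    by (rule projectiveI[OF M Fr.lin_hom_zero_map]) (use z in \<open>auto simp: zero_module_def free_ext_def\<close>)
qed

lemma submodule_incl:
  assumes M: "left_module R M" and "submodule N R M" "submodule H R M" "N \<subseteq> H"
  shows "submodule N R (M\<lparr>carrier := H\<rparr>)"
proof -
  interpret M: left_module R M by fact
  have "subgroup N ((add_monoid M)\<lparr>carrier := H\<rparr>)"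
    using assms by (intro group.subgroup_incl[OF M.M.a_group]) (auto simp: submodule_def)
  then show ?thesis using assms by (auto simp: submodule_def submodule_axioms_def)
qed

text \<open>The decisive last fact translates the zero differentials on the quotients: the
  differential lowers the filtration index by one.\<close>

lemma projective_filtrationD:
  assumes C: "is_complex R C" and F: "projective_filtration R C n G"
  shows "k \<le> n \<Longrightarrow> subcomplex R C (G k)"
    and "G 0 i = {\<zero>\<^bsub>obj C i\<^esub>}" and "G n i = carrier (obj C i)"
    and "Suc k \<le> n \<Longrightarrow> G k i \<subseteq> G (Suc k) i"
    and "Suc k \<le> n \<Longrightarrow> projective R (quot_module ((obj C i)\<lparr>carrier := G (Suc k) i\<rparr>) (G k i))"
    and "Suc k \<le> n \<Longrightarrow> x \<in> G (Suc k) i \<Longrightarrow> diff C i x \<in> G k (i - 1)"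
proof -
  show "G 0 i = {\<zero>\<^bsub>obj C i\<^esub>}" "G n i = carrier (obj C i)"
    using F by (auto simp: projective_filtration_def)
  show subc: "k \<le> n \<Longrightarrow> subcomplex R C (G k)" for k
    using F by (auto simp: projective_filtration_def)
  note sub = left_module.submoduleD[OF complex_left_module[OF C] subcomplexD(1)[OF subc]]
  have step: "G k i \<subseteq> G (Suc k) i"
    "projective R (obj (quot_cplx (sub_cplx C (G (Suc k))) (G k)) i)"
    "zero_differentials (quot_cplx (sub_cplx C (G (Suc k))) (G k))" if "Suc k \<le> n" for k i
  proof -
    have "Suc k \<in> {1..n}" using that by simp
    then show "G k i \<subseteq> G (Suc k) i"
    "projective R (obj (quot_cplx (sub_cplx C (G (Suc k))) (G k)) i)"
    "zero_differentials (quot_cplx (sub_cplx C (G (Suc k))) (G k))"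
      using F unfolding projective_filtration_def Let_def by (metis diff_Suc_1)+
  qed
  show "Suc k \<le> n \<Longrightarrow> G k i \<subseteq> G (Suc k) i" by (rule step(1))
  show "Suc k \<le> n \<Longrightarrow> projective R (quot_module ((obj C i)\<lparr>carrier := G (Suc k) i\<rparr>) (G k i))"
    using step(2)[of k i] by (simp add: quot_cplx_def)
  assume k: "Suc k \<le> n" and x: "x \<in> G (Suc k) i"
  interpret M: left_module R "obj C i" by (rule complex_left_module[OF C])
  interpret M': left_module R "obj C (i - 1)" by (rule complex_left_module[OF C])
  \<comment> \<open>This is the coset of \<open>x\<close> modulo \<open>G k i\<close>, written as an
    explicit union to match the unfolded form of the quotient complex.\<close>
  define A where "A = (\<Union>h\<in>G k i. {h \<oplus>\<^bsub>obj C i\<^esub> x})"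
  have k': "k \<le> n" using k by simp
  have xc: "x \<in> carrier (obj C i)" using x sub(1)[OF k, of i] by auto
  have "A \<in> carrier (obj (quot_cplx (sub_cplx C (G (Suc k))) (G k)) i)"
    using x by (auto simp: A_def quot_cplx_def A_RCOSETS_def' a_r_coset_def')
  then have "(\<Union>h\<in>G k (i - 1). \<Union>y\<in>diff C i ` A. {h \<oplus>\<^bsub>obj C (i - 1)\<^esub> y}) = G k (i - 1)"
    using step(3)[OF k] by (simp add: zero_differentials_def quot_cplx_def quot_map_def set_add_def')
  \<comment> \<open>Taking zero as both coset representatives exhibits \<open>diff C i x\<close> as
    an element of the image coset, which equals \<open>G k (i - 1)\<close>.\<close>
  moreover have "\<zero>\<^bsub>obj C (i - 1)\<^esub> \<oplus>\<^bsub>obj C (i - 1)\<^esub> diff C i (\<zero>\<^bsub>obj C i\<^esub> \<oplus>\<^bsub>obj C i\<^esub> x)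
      \<in> (\<Union>h\<in>G k (i - 1). \<Union>y\<in>diff C i ` A. {h \<oplus>\<^bsub>obj C (i - 1)\<^esub> y})"
    unfolding A_def using sub(2)[OF k'] by blast
  ultimately show "diff C i x \<in> G k (i - 1)"
    using xc lin_hom_closed[OF complex_diff_lin[OF C] xc] by simp
qed

text \<open>Each filtration piece is an extension of a projective quotient by the preceding piece,
  starting from the zero module.\<close>

lemma projective_filtration_projective:
  assumes C: "is_complex R C" and F: "projective_filtration R C n G" and "k \<le> n"
  shows "projective R ((obj C i)\<lparr>carrier := G k i\<rparr>)"
  using \<open>k \<le> n\<close>
proof (induction k)
  note D = projective_filtrationD[OF C F] and m = complex_left_module[OF C]
  case 0
  then show ?case
    by (intro zero_module_projective left_module.submodule_is_left_module[OF m] subcomplexD D)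
      (simp_all add: zero_module_def D)
next
  note D = projective_filtrationD[OF C F] and m = complex_left_module[OF C]
  case (Suc k)
  note s = subcomplexD(1)[OF D(1)[OF Suc.prems], of i]
  have k: "k \<le> n" using Suc.prems by simp
  note s' = subcomplexD(1)[OF D(1)[OF k], of i]
  show ?case
    using Suc.IH[OF k] D(5)[OF Suc.prems]
    by (intro projective_extension[OF left_module.submodule_is_left_module[OF m s]
      submodule_incl[OF m s' s D(4)[OF Suc.prems]]]) simp_all
qed

text \<open>The homotopy is built along the diagonal \<open>G k (c - m + k)\<close> of the filtration: the differential
  lowers both the degree and the filtration index, so extending it by one step uses exactness in just
  one degree.\<close>

lemma filtration_homotopy_diagonal:
  assumes C: "is_complex R C" and P: "is_complex R P" and F: "projective_filtration R C n G"
    and u: "chain_map R C P u"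
    and ex: "\<And>i. a < i \<Longrightarrow> i \<le> c \<Longrightarrow> cycles P i \<subseteq> boundaries P i"
    and n: "n = Suc m" "int m \<le> c - a" and "k \<le> m" and "i = c - int m + int k"
  shows "\<exists>\<sigma> \<in> lin_hom R ((obj C i)\<lparr>carrier := G k i\<rparr>) (obj P (i + 1)).
     \<forall>x \<in> G k i. x \<in> cycles C i \<longrightarrow> u i x = diff P (i + 1) (\<sigma> x)"
  using \<open>k \<le> m\<close> \<open>i = _\<close>
proof (induction k arbitrary: i)
  note D = projective_filtrationD[OF C F]
  note mC = complex_left_module[OF C] and mP = complex_left_module[OF P]
  case 0
  show ?case
    using left_module.lin_hom_zero_map[OF mP]
      lin_hom_zero[OF mC mP chain_map_lin[OF u]] lin_hom_zero[OF mP mP complex_diff_lin_Suc[OF P]]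
    by (intro bexI[of _ "\<lambda>x. \<zero>\<^bsub>obj P (i + 1)\<^esub>"]) (auto simp: D(2))
next
  note D = projective_filtrationD[OF C F]
  note mC = complex_left_module[OF C] and mP = complex_left_module[OF P]
  case (Suc k j)
  define i where "i = j - 1"
  have j: "j = i + 1" by (simp add: i_def)
  have kn: "Suc k \<le> n" "k \<le> n" using Suc.prems n by auto
  have "k \<le> m" "i = c - int m + int k" using Suc.prems by (auto simp: i_def)
  from Suc.IH[OF this] obtain \<sigma>
    where s: "\<sigma> \<in> lin_hom R ((obj C i)\<lparr>carrier := G k i\<rparr>) (obj P (i + 1))"
      and s_eq: "\<And>x. x \<in> G k i \<Longrightarrow> x \<in> cycles C i \<Longrightarrow> u i x = diff P (i + 1) (\<sigma> x)" by blast
  interpret P1: left_module R "obj P (i + 1)" by (rule mP)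
  interpret P0: left_module R "obj P i" by (rule mP)
  let ?M = "(obj C (i + 1))\<lparr>carrier := G (Suc k) (i + 1)\<rparr>"
  have sub: "G (Suc k) (i + 1) \<subseteq> carrier (obj C (i + 1))"
    by (rule left_module.submoduleD(1)[OF mC subcomplexD(1)[OF D(1)[OF kn(1)]]])
  have dG: "diff C (i + 1) x \<in> G k i" if "x \<in> G (Suc k) (i + 1)" for x
    using D(6)[OF kn(1) that] by simp
  have d: "diff C (i + 1) \<in> lin_hom R ?M ((obj C i)\<lparr>carrier := G k i\<rparr>)"
    by (rule lin_hom_corestrict[OF lin_hom_restrict[OF complex_diff_lin_Suc[OF C] sub]]) (simp add: dG)
  note u1 = lin_hom_restrict[OF chain_map_lin[OF u, of "i + 1"] sub]
  \<comment> \<open>The homotopy already built handles the boundary of \<open>x\<close>, which is a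
    cycle one filtration index lower. Hence \<open>?w\<close> takes values in cycles, and exactness
    of \<open>P\<close> in degree \<open>i + 1\<close> allows it to be lifted.\<close>
  let ?w = "\<lambda>x. u (i + 1) x \<ominus>\<^bsub>obj P (i + 1)\<^esub> \<sigma> (diff C (i + 1) x)"
  note w = P1.lin_hom_diff[OF u1 lin_hom_comp[OF d s]]
  note dP = complex_diff_lin_Suc[OF P, of i]
  have "?w x \<in> boundaries P (i + 1)" if x: "x \<in> carrier ?M" for x
  proof -
    have xc: "x \<in> carrier (obj C (i + 1))" using x sub by auto
    have dx: "diff C (i + 1) x \<in> G k i" "diff C (i + 1) x \<in> cycles C i"
      using dG x complex_diff_diff_Suc[OF C xc] lin_hom_closed[OF complex_diff_lin_Suc[OF C] xc]
      by (auto simp: cycles_iff)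
    have sc: "\<sigma> (diff C (i + 1) x) \<in> carrier (obj P (i + 1))" using lin_hom_closed[OF s] dx(1) by simp
    have "diff P (i + 1) (?w x) = u i (diff C (i + 1) x) \<ominus>\<^bsub>obj P i\<^esub> u i (diff C (i + 1) x)"
      by (simp only: lin_hom_minus[OF mP mP dP lin_hom_closed[OF u1 x] sc] chain_map_diff_Suc[OF u xc] s_eq[OF dx, symmetric])
    also have "\<dots> = \<zero>\<^bsub>obj P i\<^esub>"
      using lin_hom_closed[OF chain_map_lin[OF u], of "diff C (i + 1) x" i] dx(2)
      by (simp add: cycles_iff a_minus_def P0.M.r_neg)
    finally have "?w x \<in> cycles P (i + 1)" using lin_hom_closed[OF w x] by (simp add: cycles_iff)
    \<comment> \<open>The degree reached is \<open>c - int m + int (Suc k)\<close>. It exceeds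
      \<open>a\<close> by \<open>int m \<le> c - a\<close> and is at most \<open>c\<close> by
      \<open>Suc k \<le> m\<close>.\<close>
    moreover have "a < i + 1" "i + 1 \<le> c" using Suc.prems n by (auto simp: i_def)
    ultimately show ?thesis using ex by blast
  qed
  then have "\<exists>z\<in>carrier (obj P (i + 1 + 1)). ?w x = diff P (i + 1 + 1) z" if "x \<in> carrier ?M" for x
    using that by (auto simp: boundaries_iff)
  then obtain \<tau> where t: "\<tau> \<in> lin_hom R ?M (obj P (i + 1 + 1))"
    and t_eq: "\<And>x. x \<in> carrier ?M \<Longrightarrow> ?w x = diff P (i + 1 + 1) (\<tau> x)"
    using projective_lift[OF projective_filtration_projective[OF C F kn(1)] mP mP
        complex_diff_lin_Suc[OF P] w] by blast
  have "u (i + 1) x = diff P (i + 1 + 1) (\<tau> x)" if x: "x \<in> G (Suc k) (i + 1)" "x \<in> cycles C (i + 1)" for x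
  proof -
    have "\<sigma> \<zero>\<^bsub>obj C i\<^esub> = \<zero>\<^bsub>obj P (i + 1)\<^esub>"
      using lin_hom_zero[OF left_module.submodule_is_left_module[OF mC subcomplexD(1)[OF D(1)[OF kn(2)]]] mP s] by simp
    then have "?w x = u (i + 1) x"
      using x lin_hom_closed[OF u1, of x] by (simp add: cycles_iff a_minus_def)
    then show ?thesis using t_eq[of x] x by simp
  qed
  then show ?case using t unfolding j by blast
qed

text \<open>The diagonal construction ends at \<open>G m c\<close> with \<open>n = Suc m\<close>.
  This index suffices because boundaries of \<open>C\<close> in degree \<open>c\<close> already lie
  in \<open>G m c\<close>. The final filtration step thus costs no exactness, which accounts for the
  bound \<open>c + 1 - a\<close> instead of \<open>c - a\<close>.\<close>

lemma filtration_homotopy: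
  assumes C: "is_complex R C" and P: "is_complex R P" and F: "projective_filtration R C n G"
    and u: "chain_map R C P u"
    and ex: "\<And>i. a < i \<Longrightarrow> i \<le> c \<Longrightarrow> cycles P i \<subseteq> boundaries P i"
    and n: "int n \<le> c + 1 - a"
  shows "\<exists>\<sigma> \<in> lin_hom R (obj C c) (obj P (c + 1)). \<forall>x \<in> carrier (obj C (c + 1)).
     diff P (c + 1) (u (c + 1) x) = diff P (c + 1) (\<sigma> (diff C (c + 1) x))"
proof (cases n)
  note D = projective_filtrationD[OF C F]
  note mC = complex_left_module[OF C] and mP = complex_left_module[OF P]
  case 0
  have "diff P (c + 1) (u (c + 1) x) = diff P (c + 1) \<zero>\<^bsub>obj P (c + 1)\<^esub>"
    if "x \<in> carrier (obj C (c + 1))" for x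
  proof -
    \<comment> \<open>A filtration of length zero forces \<open>C\<close> to be the zero
      complex.\<close>
    have "x = \<zero>\<^bsub>obj C (c + 1)\<^esub>" using that D(2)[of "c + 1"] D(3)[of "c + 1"] 0 by auto
    then show ?thesis using lin_hom_zero[OF mC mP chain_map_lin[OF u]] by simp
  qed
  then show ?thesis by (intro bexI[OF _ left_module.lin_hom_zero_map[OF mP]] ballI)
next
  note D = projective_filtrationD[OF C F]
  note mC = complex_left_module[OF C] and mP = complex_left_module[OF P]
  case (Suc m)
  have "int m \<le> c - a" using n Suc by simp
  \<comment> \<open>Instantiating \<open>k = m\<close> puts the diagonal in degree
    \<open>c\<close>.\<close>
  from filtration_homotopy_diagonal[OF C P F u ex Suc this order.refl, of c] obtain \<sigma>
    where s: "\<sigma> \<in> lin_hom R ((obj C c)\<lparr>carrier := G m c\<rparr>) (obj P (c + 1))"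
      and s_eq: "\<And>x. x \<in> G m c \<Longrightarrow> x \<in> cycles C c \<Longrightarrow> u c x = diff P (c + 1) (\<sigma> x)" by auto
  have sm: "submodule (G m c) R (obj C c)" by (rule subcomplexD(1)[OF D(1)]) (simp add: Suc)
  \<comment> \<open>The top piece \<open>G n c\<close> is all of \<open>C\<close> in degree
    \<open>c\<close>, so \<open>G m c\<close> is a direct summand there and \<open>\<sigma>\<close>
    extends by precomposition with a retraction.\<close>
  have "projective R (quot_module (obj C c) (G m c))"
    using D(5)[of m c] D(3)[of c] by (simp add: Suc)
  then obtain \<rho> where r: "\<rho> \<in> lin_hom R (obj C c) ((obj C c)\<lparr>carrier := G m c\<rparr>)"
    and r_eq: "\<And>x. x \<in> G m c \<Longrightarrow> \<rho> x = x"
    using projective_quot_retraction[OF mC sm] by metis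
  have "diff P (c + 1) (u (c + 1) x) = diff P (c + 1) (\<sigma> (\<rho> (diff C (c + 1) x)))"
    if x: "x \<in> carrier (obj C (c + 1))" for x
  proof -
    have "diff C (c + 1) x \<in> G m c" using D(6)[of m x "c + 1"] D(3)[of "c + 1"] x by (simp add: Suc)
    moreover have "diff C (c + 1) x \<in> cycles C c"
      using complex_diff_diff_Suc[OF C x] lin_hom_closed[OF complex_diff_lin_Suc[OF C] x] by (simp add: cycles_iff)
    ultimately show ?thesis using s_eq r_eq chain_map_diff_Suc[OF u x] by simp
  qed
  then show ?thesis by (intro bexI[OF _ lin_hom_comp[OF r s]] ballI)
qed

section \<open>Projectivity of the syzygy module and the lower bound\<close>

section \<open>Syzygies\<close>

text \<open>After truncation every element in degree 0 is a cycle. The shift may change the sign of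
  the incoming differential, but a submodule equals its set of negatives, so the boundaries are the
  original ones.\<close>

lemma homology_syzygy:
  assumes P: "is_complex R P"
  shows "homology (syzygy c P) 0 = quot_module (obj P c) (boundaries P c)"
proof -
  note m = complex_left_module[OF P]
  interpret M: left_module R "obj P c" by (rule m)
  interpret M1: left_module R "obj P (c + 1)" by (rule m)
  interpret L: left_module R "obj P (c - 1)" by (rule m)
  note d = complex_diff_lin_Suc[OF P, of c]
  interpret h: abelian_group_hom "obj P (c + 1)" "obj P c" "diff P (c + 1)"
    by (rule lin_hom_abelian_group_hom[OF m m d])
  have "submodule {\<zero>\<^bsub>obj P (c - 1)\<^esub>} R (obj P (c - 1))" by (rule L.submoduleI) auto
  then interpret Z: left_module R "(obj P (c - 1))\<lparr>carrier := {\<zero>\<^bsub>obj P (c - 1)\<^esub>}\<rparr>"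
    by (rule L.submodule_is_left_module)
  have o0: "obj (syzygy c P) 0 = obj P c" by (simp add: syzygy_def shift_def hard_trunc_def)
  have c0: "cycles (syzygy c P) 0 = carrier (obj P c)"
    using Z.M.add.inv_one
    by (auto simp: cycles_iff o0 syzygy_def shift_def hard_trunc_def a_inv_def)
  have "boundaries (syzygy c P) 0 =
      (\<lambda>x. if even c then diff P (c + 1) x else \<ominus>\<^bsub>obj P c\<^esub> diff P (c + 1) x) ` carrier (obj P (c + 1))"
    by (auto simp: boundaries_def syzygy_def shift_def hard_trunc_def add.commute)
  also have "\<dots> = diff P (c + 1) ` carrier (obj P (c + 1))"
  proof (cases "even c")
    case False
    \<comment> \<open>A sign on the differential is absorbed by negating its argument.\<close>
    have "diff P (c + 1) x \<in> (\<lambda>x. \<ominus>\<^bsub>obj P c\<^esub> diff P (c + 1) x) ` carrier (obj P (c + 1))"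
      if "x \<in> carrier (obj P (c + 1))" for x
      by (rule image_eqI[of _ _ "\<ominus>\<^bsub>obj P (c + 1)\<^esub> x"]) (use that in simp_all)
    moreover have "\<ominus>\<^bsub>obj P c\<^esub> diff P (c + 1) x \<in> diff P (c + 1) ` carrier (obj P (c + 1))"
      if "x \<in> carrier (obj P (c + 1))" for x
      using that by (simp flip: h.hom_a_inv)
    ultimately show ?thesis using False by (simp only: if_False) blast
  qed simp
  finally show ?thesis unfolding homology_def o0 c0 by (simp add: boundaries_def)
qed

text \<open>A cycle of \<open>P\<close> maps to a cycle of \<open>F\<close>, which bounds since the
  homology vanishes; injectivity on homology brings this back to \<open>P\<close>.\<close>

lemma projective_resolution_exact:
  assumes f: "weak_equiv R P F f" and z: "zero_module (homology F i)"
  shows "cycles P i \<subseteq> boundaries P i"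
proof
  note F = weak_equivD[OF f]
  fix x assume x: "x \<in> cycles P i"
  show "x \<in> boundaries P i"
    by (rule F(4)[OF x zero_homologyD[OF F(2) z chain_map_cycles[OF F(1,2,3) x]]])
qed

text \<open>This is the contrapositive of the bound for one witness \<open>C\<close>: a filtration
  of length at most \<open>b - a\<close> makes the boundaries a retract of \<open>P\<close> in
  degree \<open>b - 1\<close>.\<close>

lemma syzygy_projective:
  assumes P: "projective_resolution R P F" and C: "is_complex R C"
    and G: "projective_filtration R C n G" and S: "direct_summand R C S"
    and FS: "quasi_isomorphic R F (sub_cplx C S)"
    and ex: "\<And>i. a < i \<Longrightarrow> i < b \<Longrightarrow> zero_module (homology F i)"
    and n: "int n \<le> b - a"
  shows "projective R (homology (syzygy (b - 1) P) 0)"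
proof -
  obtain p where p: "weak_equiv R P F p" and prP: "\<And>i. projective R (obj P i)"
    using P quasi_iso_weak_equiv unfolding projective_resolution_def by metis
  have Pc: "is_complex R P" using weak_equivD[OF p] by blast
  define c where "c = b - 1"
  have Ssub: "subcomplex R C S" using S by (simp add: direct_summand_def)
  obtain r where r: "chain_map R C (sub_cplx C S) r" and rS: "\<And>i x. x \<in> S i \<Longrightarrow> r i x = x"
    by (rule direct_summand_retraction[OF C S]) blast
  have Sc: "is_complex R (sub_cplx C S)" by (rule sub_cplx_complex[OF C Ssub])
  have prC: "projective R (obj C i)" for i
    using projective_filtration_projective[OF C G order.refl, of i] projective_filtrationD(3)[OF C G, of i] by simp
  have SC: "S i \<subseteq> carrier (obj C i)" for i
    by (rule left_module.submoduleD(1)[OF complex_left_module[OF C] subcomplexD(1)[OF Ssub]])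
  \<comment> \<open>Each module of the summand is a retract of a projective one, with the inclusion
    as section; this is what permits lifting maps out of the summand.\<close>
  have prS: "projective R (obj (sub_cplx C S) i)" for i
    by (rule projective_retract[OF prC complex_left_module[OF Sc] _ chain_map_lin[OF r], of "\<lambda>x. x"])
      (simp_all add: lin_hom_restrict[OF lin_hom_id SC] rS)
  obtain e where "weak_equiv R (sub_cplx C S) F e"
    using quasi_isomorphic_weak_equiv[OF Sc prS FS] by blast
  then obtain f where f: "weak_equiv R (sub_cplx C S) P f" using weak_equiv_lift[OF prS p] by blast
  note fc = weak_equivD(3)[OF f]
  have idP: "chain_map R P P (\<lambda>i x. x)" by (simp add: chain_map_def lin_hom_id)
  \<comment> \<open>Lifting the identity of \<open>P\<close> through \<open>f\<close> produces a
    one-sided homotopy inverse \<open>g\<close> together with the homotopy \<open>t\<close>.\<close>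
  obtain g t where g: "chain_map R P (sub_cplx C S) g" and t: "\<And>i. t i \<in> lin_hom R (obj P i) (obj P (i + 1))"
    and gt: "\<And>i x. x \<in> carrier (obj P (i + 1)) \<Longrightarrow>
       x = f (i + 1) (g (i + 1) x) \<oplus>\<^bsub>obj P (i + 1)\<^esub> diff P (i + 1 + 1) (t (i + 1) x)
          \<oplus>\<^bsub>obj P (i + 1)\<^esub> t i (diff P (i + 1) x)"
    using chain_map_lift[OF Pc prP f idP] by blast
  have "cycles P i \<subseteq> boundaries P i" if "a < i" "i \<le> c" for i
    using projective_resolution_exact[OF p ex] that by (simp add: c_def)
  then obtain \<sigma> where s: "\<sigma> \<in> lin_hom R (obj C c) (obj P (c + 1))"
    and s_eq: "\<And>x. x \<in> carrier (obj C (c + 1)) \<Longrightarrow>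
      diff P (c + 1) (f (c + 1) (r (c + 1) x)) = diff P (c + 1) (\<sigma> (diff C (c + 1) x))"
    using filtration_homotopy[OF C Pc G chain_map_comp[OF r fc], of a c] n by (auto simp: c_def)
  note mP = complex_left_module[OF Pc]
  interpret P0: left_module R "obj P c" by (rule mP)
  interpret P1: left_module R "obj P (c + 1)" by (rule mP)
  \<comment> \<open>The values of \<open>g\<close> lie in the summand, but \<open>\<sigma>\<close>
    is defined on all of \<open>C\<close> in degree \<open>c\<close>, so the codomain is
    widened.\<close>
  have gC: "g c \<in> lin_hom R (obj P c) (obj C c)"
    using lin_hom_expand[OF _ SC] chain_map_lin[OF g, of c] by auto
  \<comment> \<open>For \<open>y = diff P (c + 1) x\<close>, applying the differential to the
    homotopy identity for \<open>x\<close> leaves the boundary of \<open>t c y\<close> plus that of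
    \<open>f g x\<close>. The second term is rewritten with \<open>\<sigma>\<close> into an
    expression in \<open>y\<close> alone, and the sum is \<open>h y\<close>.\<close>
  define h where "h = (\<lambda>y. diff P (c + 1) (t c y \<oplus>\<^bsub>obj P (c + 1)\<^esub> \<sigma> (g c y)))"
  note ts = P1.lin_hom_plus[OF t[of c] lin_hom_comp[OF gC s]]
  note d = complex_diff_lin_Suc[OF Pc, of c]
  have h: "h \<in> lin_hom R (obj P c) (obj P c)" unfolding h_def by (rule lin_hom_comp[OF ts d])
  have hB: "h y \<in> boundaries P c" if "y \<in> carrier (obj P c)" for y
    using lin_hom_closed[OF ts that] by (auto simp: h_def boundaries_iff)
  have "h y = y" if yb: "y \<in> boundaries P c" for y
  proof -
    obtain x where x: "x \<in> carrier (obj P (c + 1))" and y: "y = diff P (c + 1) x"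
      using yb by (auto simp: boundaries_iff)
    have yc: "y \<in> carrier (obj P c)" using lin_hom_closed[OF d x] by (simp add: y)
    have gx: "g (c + 1) x \<in> S (c + 1)" using lin_hom_closed[OF chain_map_lin[OF g] x] by simp
    have gxc: "g (c + 1) x \<in> carrier (obj C (c + 1))" using gx SC by blast
    have fgx: "f (c + 1) (g (c + 1) x) \<in> carrier (obj P (c + 1))"
      using lin_hom_closed[OF lin_hom_comp[OF chain_map_lin[OF g] chain_map_lin[OF fc]] x] .
    have dtx: "diff P (c + 1 + 1) (t (c + 1) x) \<in> carrier (obj P (c + 1))"
      by (rule lin_hom_closed[OF complex_diff_lin_Suc[OF Pc] lin_hom_closed[OF t x]])
    have ddtx: "diff P (c + 1) (diff P (c + 1 + 1) (t (c + 1) x)) = \<zero>\<^bsub>obj P c\<^esub>"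
      using complex_diff_diff_Suc[OF Pc lin_hom_closed[OF t x]] by simp
    have ty: "t c y \<in> carrier (obj P (c + 1))" by (rule lin_hom_closed[OF t yc])
    have sgy: "\<sigma> (g c y) \<in> carrier (obj P (c + 1))" by (rule lin_hom_closed[OF lin_hom_comp[OF gC s] yc])
    note dc = lin_hom_closed[OF d ty] lin_hom_closed[OF d sgy] lin_hom_closed[OF d fgx]
    have gd: "g c y = diff C (c + 1) (g (c + 1) x)" using chain_map_diff_Suc[OF g x] by (simp add: y)
    \<comment> \<open>The equation for \<open>\<sigma>\<close> involves \<open>f\<close> after
      \<open>r\<close>; since \<open>g\<close> takes values in the summand, \<open>r\<close> acts
      there as the identity.\<close>
    have "diff P (c + 1) (f (c + 1) (g (c + 1) x)) = diff P (c + 1) (\<sigma> (g c y))"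
      using s_eq[OF gxc] by (simp add: rS[OF gx] gd)
    moreover have "y = diff P (c + 1) (f (c + 1) (g (c + 1) x) \<oplus>\<^bsub>obj P (c + 1)\<^esub> diff P (c + 1 + 1) (t (c + 1) x)
          \<oplus>\<^bsub>obj P (c + 1)\<^esub> t c y)"
      using gt[OF x] by (simp add: y)
    then have "y = diff P (c + 1) (f (c + 1) (g (c + 1) x)) \<oplus>\<^bsub>obj P c\<^esub> diff P (c + 1) (t c y)"
      using dc
      by (simp only: lin_hom_add[OF d P1.M.a_closed[OF fgx dtx] ty] lin_hom_add[OF d fgx dtx] ddtx P0.M.r_zero)
    ultimately show ?thesis
      using dc by (simp add: h_def lin_hom_add[OF d ty sgy] P0.M.a_comm)
  qed
  then have "projective R (quot_module (obj P c) (boundaries P c))"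
    using projective_quot_of_retraction[OF prP boundaries_submodule[OF Pc] h hB] by blast
  then show ?thesis using homology_syzygy[OF Pc, of c] by (simp add: c_def)
qed

theorem theorem2p1:
  fixes R :: "('r, 'x) ring_scheme"
    and F :: "('r, 'm) cplx"
    and P :: "('r, 'p) cplx"
    and a b :: int
  assumes "ring R"
    and "is_complex R F"
    and "\<forall>i. a < i \<and> i < b \<longrightarrow> zero_module (homology F i)"
    and "projective_resolution R P F"
    and "\<not> projective R (homology (syzygy (b - 1) P) 0)"
  shows "proj_level TYPE('u) R F \<ge> enat (nat (b - a + 1))"
  unfolding proj_level_def
proof (rule Inf_greatest, clarify)
  fix n S G and C :: "('r, 'u) cplx"
  assume "is_complex R C" "projective_filtration R C n G" "direct_summand R C S"
    "quasi_isomorphic R F (sub_cplx C S)"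
  \<comment> \<open>Every admissible \<open>n\<close> must exceed \<open>b - a\<close>, since
    otherwise the syzygy module would be projective.\<close>
  then have "\<not> int n \<le> b - a" using syzygy_projective[OF assms(4)] assms(3,5) by blast
  \<comment> \<open>For integers, exceeding \<open>b - a\<close> means being at least
    \<open>b - a + 1\<close>; should that number be negative, \<open>nat\<close> turns it into 0 and
    the bound is trivial.\<close>
  then show "enat (nat (b - a + 1)) \<le> enat n" by simp
qed

end
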